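(* Let $A\in\mathbb{R}^{d\times d}$, let $1\le\ell<k<d$, let $\varepsilon>0$, and let $Q\in\mathbb{R}^{d\times k}$ be a random matrix such that $Q^*Q=I$. Suppose that for some $\delta\in(0,1]$ and some number $\alpha_k(A)$, $$\mathbb{P}\{\|(I-QQ^* )A\|>\alpha_k(A)\}\le\delta,$$ and let $Q^*A=\hat U_k\hat\Sigma_k\hat V_k^*$ be the singular value decomposition of $Q^*A$. Then with probability at least $1-\delta$, $$\Lambda_\varepsilon(A)\subseteq\Big\{z\in\mathbb{C}:\ \mu_{Q\hat U_\ell,\hat V_\ell\hat\Sigma_\ell}(z)\le\varepsilon+\hat\sigma_{\ell+1}+\alpha_k(A)\Big\}.$$
   Context: $\|\cdot\|$ is the spectral norm and $^*$ is (conjugate) transpose. In $Q^*A=\hat U_k\hat\Sigma_k\hat V_k^*$, $\hat U_k\in\mathbb{R}^{k\times k}$ and $\hat V_k\in\mathbb{R}^{d\times k}$ have orthonormal columns and $\hat\Sigma_k=\mathrm{diag}(\hat\sigma_1,\dots,\hat\sigma_k)$ with $\hat\sigma_1\ge\dots\ge\hat\sigma_k\ge0$; $\hat U_\ell,\hat V_\ell$ consist of the first $\ell$ columns of $\hat U_k,\hat V_k$ and $\hat\Sigma_\ell=\mathrm{diag}(\hat\sigma_1,\dots,\hat\sigma_\ell)$. For $U,V\in\mathbb{C}^{d\times\ell}$ and $z\in\mathbb{C}$, $$\mathcal{M}_{U,V}(z):=\begin{bmatrix} |z|^2 I - z\,U^*V & (|z|^2 I - z\,U^*V)\,U^*U\\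 V^*V & |z|^2 I-\overline{z}\,V^*U+V^*V\,U^*U\end{bmatrix}\in\mathbb{C}^{2\ell\times 2\ell},$$ whose eigenvalues are real and nonnegative when $\ell<d$, and $\mu_{U,V}(z):=\sqrt{\lambda_{\min}(\mathcal{M}_{U,V}(z))}$, with $\lambda_{\min}$ the smallest eigenvalue. The $\varepsilon$-pseudospectrum is $\Lambda_\varepsilon(A)=\{z\in\mathbb{C}:\|(A-zI)^{-1}\|^{-1}\le\varepsilon\}$, with $\|(A-zI)^{-1}\|^{-1}:=0$ when $A-zI$ is singular. *)

theory Defs
  imports "HOL-Probability.Probability" "Jordan_Normal_Form.Spectral_Radius"
begin

definition l2_norm :: "'a :: real_normed_field Matrix.vec \<Rightarrow> real" where
  "l2_norm v = L2_set (\<lambda>i. norm (vec_index v i)) {..<dim_vec v}"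

definition spectral_norm :: "'a :: real_normed_field mat \<Rightarrow> real" where
  "spectral_norm A = (SUP v \<in> {v \<in> carrier_vec (dim_col A). l2_norm v \<le> 1}. l2_norm (A *\<^sub>v v))"

abbreviation complex_mat :: "real mat \<Rightarrow> complex mat" where
  "complex_mat \<equiv> map_mat complex_of_real"

definition recip_norm_inverse :: "complex mat \<Rightarrow> real" where
  "recip_norm_inverse B =
    (case mat_inverse B of None \<Rightarrow> 0 | Some R \<Rightarrow> inverse (spectral_norm R))"

definition pseudospectrum :: "real \<Rightarrow> complex mat \<Rightarrow> complex set" where
  "pseudospectrum \<epsilon> A = {z. recip_norm_inverse (A - z \<cdot>\<^sub>m 1\<^sub>m (dim_row A)) \<le> \<epsilon>}"

definition calM :: "complex mat \<Rightarrow> complex mat \<Rightarrow> complex \<Rightarrow> complex mat" where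
  "calM U V z =
    (let l = dim_col U;
         Us = mat_adjoint U;
         Vs = mat_adjoint V;
         N = complex_of_real ((cmod z)\<^sup>2) \<cdot>\<^sub>m 1\<^sub>m l
     in four_block_mat
          (N - z \<cdot>\<^sub>m (Us * V))  ((N - z \<cdot>\<^sub>m (Us * V)) * (Us * U))
          (Vs * V)             (N - cnj z \<cdot>\<^sub>m (Vs * U) + Vs * V * (Us * U)))"

text \<open>The matrices of interest are not Hermitian, but their eigenvalues are real; taking real
  parts only transfers the spectrum to an ordered type.\<close>

definition lambda_min :: "complex mat \<Rightarrow> real" where
  "lambda_min B = Min (Re ` spectrum B)"

definition mu :: "complex mat \<Rightarrow> complex mat \<Rightarrow> complex \<Rightarrow> real" where
  "mu U V z = sqrt (lambda_min (calM U V z))"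

text \<open>Singular values are numbered from 1, whereas matrix indices start at 0.\<close>

definition sv_diag :: "nat \<Rightarrow> (nat \<Rightarrow> real) \<Rightarrow> real mat" where
  "sv_diag m \<sigma> = mat_diag m (\<lambda>i. \<sigma> (Suc i))"

text \<open>The reduced decomposition of a wide matrix: \<open>U\<close> is square and \<open>V\<close> has as many columns
  as \<open>B\<close> has rows.\<close>

definition is_svd :: "real mat \<Rightarrow> real mat \<Rightarrow> (nat \<Rightarrow> real) \<Rightarrow> real mat \<Rightarrow> bool" where
  "is_svd B U \<sigma> V \<longleftrightarrow>
    (let k = dim_row B; d = dim_col B in
      U \<in> carrier_mat k k \<and> U\<^sup>T * U = 1\<^sub>m k \<and>
      V \<in> carrier_mat d k \<and> V\<^sup>T * V = 1\<^sub>m k \<and>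
      (\<forall>i\<in>{1..k}. 0 \<le> \<sigma> i) \<and> antimono_on {1..k} \<sigma> \<and>
      B = U * sv_diag k \<sigma> * V\<^sup>T)"

definition first_cols :: "nat \<Rightarrow> 'a mat \<Rightarrow> 'a mat" where
  "first_cols l A = mat_of_cols (dim_row A) (take l (cols A))"

definition random_matrix :: "'w measure \<Rightarrow> nat \<Rightarrow> nat \<Rightarrow> ('w \<Rightarrow> real mat) \<Rightarrow> bool" where
  "random_matrix M m n X \<longleftrightarrow>
    (\<forall>\<omega>\<in>space M. X \<omega> \<in> carrier_mat m n) \<and>
    (\<forall>i<m. \<forall>j<n. (\<lambda>\<omega>. X \<omega> $$ (i, j)) \<in> borel_measurable M)"

text \<open>No measurability in \<open>\<omega>\<close> is imposed on \<open>P\<close>, since a pointwise choice of singular vectors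
  need not be measurable.\<close>

definition with_prob_at_least :: "'w measure \<Rightarrow> real \<Rightarrow> ('w \<Rightarrow> bool) \<Rightarrow> bool" where
  "with_prob_at_least M p P \<longleftrightarrow> (\<exists>E\<in>sets M. p \<le> measure M E \<and> (\<forall>\<omega>\<in>E. P \<omega>))"

lemma (in prob_space) with_prob_at_least_iff:
  assumes "{\<omega>\<in>space M. P \<omega>} \<in> events"
  shows "with_prob_at_least M p P \<longleftrightarrow> p \<le> prob {\<omega>\<in>space M. P \<omega>}"
proof
  assume "with_prob_at_least M p P"
  then obtain E where E: "E \<in> events" and pE: "p \<le> prob E" and PE: "\<forall>\<omega>\<in>E. P \<omega>"
    unfolding with_prob_at_least_def by blast
  have "E \<subseteq> {\<omega>\<in>space M. P \<omega>}"
    using sets.sets_into_space[OF E] PE by blast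
  then have "prob E \<le> prob {\<omega>\<in>space M. P \<omega>}"
    using assms by (rule finite_measure_mono)
  then show "p \<le> prob {\<omega>\<in>space M. P \<omega>}"
    using pE by (rule order_trans[rotated])
next
  assume "p \<le> prob {\<omega>\<in>space M. P \<omega>}"
  then show "with_prob_at_least M p P"
    unfolding with_prob_at_least_def using assms by blast
qed

end

(* Write X (a, b) = V a + V U^* U b - conj(z) U b and Y x = (-z U^* x, V^* x). For K = U V^* - z I one
   has K^* K = |z|^2 I + X Y, whereas calM U V z = |z|^2 I + Y X. The smallest eigenvalue m of K^* K
   is therefore also an eigenvalue of calM U V z: if m differs from |z|^2, then Y maps an
   eigenvector to an eigenvector, and if m = |z|^2, then X has a nontrivial kernel. Hence
   mu U V z is at most the smallest singular value of K. With U V^* the truncated decomposition of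
   Q Q^* A, the matrix A - U V^* has norm at most sigma (l + 1) + alpha outside the exceptional event,
   and the smallest singular value of A - z I is at most epsilon on the pseudospectrum. *)

theory Submission
  imports Defs
begin

text \<open>Exchanging X Y for Y X preserves the nonzero spectrum only. If 2 l < d, then X Y is
  singular whatever U and V are, while nothing in the factorisation forces Y X to be singular. The
  case m = |z|^2 therefore rests on m being the smallest eigenvalue. For this reason the existence
  lemma for m supplies, next to an eigenvector, the inequality m |x|^2 \<le> |K x|^2 for all x: the
  degenerate case uses it as a variational principle, and the final estimate uses it with a test
  vector. An upper bound for \<open>lambda_min\<close> then takes just one eigenvalue of
  \<open>calM U V z\<close>. The test vector is complex and comes from the pseudospectrum with an
  arbitrarily small loss, whereas the error of the truncation is estimated over the reals. Chance
  enters only through the exceptional event; outside it the argument is made for each sample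
  separately.\<close>

unbundle no vec_syntax
unbundle no inner_syntax

section \<open>Euclidean norm and spectral norm\<close>

lemma smult_mat_mult_vec:
  fixes A :: "'a :: comm_semiring_0 mat"
  assumes "dim_vec v = dim_col A"
  shows "(k \<cdot>\<^sub>m A) *\<^sub>v v = k \<cdot>\<^sub>v (A *\<^sub>v v)"
  using assms by (intro eq_vecI) (auto simp: scalar_prod_def sum_distrib_left mult.assoc)

lemma mult_mat_zero_vec:
  fixes A :: "'a :: semiring_0 mat"
  shows "A \<in> carrier_mat m n \<Longrightarrow> A *\<^sub>v 0\<^sub>v n = 0\<^sub>v m"
  by (intro eq_vecI) (auto simp: scalar_prod_def)

lemma smult_zero_vec: "k \<cdot>\<^sub>v 0\<^sub>v n = (0\<^sub>v n :: 'a :: mult_zero Matrix.vec)"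
  by (intro eq_vecI) auto

lemma l2_norm_nonneg [simp]: "0 \<le> l2_norm v"
  by (simp add: l2_norm_def)

lemma l2_norm_zero [simp]: "l2_norm (0\<^sub>v n) = 0"
  by (simp add: l2_norm_def L2_set_0')

lemma l2_norm_eq_0_iff:
  assumes "v \<in> carrier_vec n"
  shows "l2_norm v = 0 \<longleftrightarrow> v = 0\<^sub>v n"
  using assms by (auto simp: l2_norm_def L2_set_eq_0_iff)

lemma l2_norm_pos_iff:
  assumes "v \<in> carrier_vec n"
  shows "0 < l2_norm v \<longleftrightarrow> v \<noteq> 0\<^sub>v n"
  using l2_norm_eq_0_iff[OF assms] l2_norm_nonneg[of v] by (auto simp: order_less_le)

lemma l2_norm_smult: "l2_norm (a \<cdot>\<^sub>v v) = norm a * l2_norm v"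
  by (auto simp: l2_norm_def norm_mult L2_set_right_distrib intro!: L2_set_cong)

lemma l2_norm_add_le:
  assumes "v \<in> carrier_vec n" "w \<in> carrier_vec n"
  shows "l2_norm (v + w) \<le> l2_norm v + l2_norm w"
proof -
  have "l2_norm (v + w) \<le> L2_set (\<lambda>i. norm (v $ i) + norm (w $ i)) {..<n}"
    using assms by (auto simp: l2_norm_def norm_triangle_ineq intro!: L2_set_mono)
  also have "\<dots> \<le> l2_norm v + l2_norm w"
    using assms by (auto simp: l2_norm_def intro: L2_set_triangle_ineq)
  finally show ?thesis .
qed

lemma l2_norm_minus_le:
  assumes "v \<in> carrier_vec n" "w \<in> carrier_vec n"
  shows "l2_norm (v - w) \<le> l2_norm v + l2_norm w"
proof -
  have "v - w = v + (-1) \<cdot>\<^sub>v w"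
    using assms by auto
  then show ?thesis
    using l2_norm_add_le[of v n "(-1) \<cdot>\<^sub>v w"] assms by (simp add: l2_norm_smult)
qed

text \<open>Cauchy-Schwarz in each row. The constant is crude, but it makes the supremum in
  \<open>spectral_norm\<close> that of a bounded set, and its strict sign allows division by it in
  \<open>smallest_eigenvalue_adjoint_mult\<close>.\<close>

lemma l2_norm_mult_mat_vec_bounded:
  fixes A :: "'a :: real_normed_field mat"
  obtains C where "0 < C" "\<And>v. v \<in> carrier_vec (dim_col A) \<Longrightarrow> l2_norm (A *\<^sub>v v) \<le> C * l2_norm v"
proof
  define C where "C = (\<Sum>i<dim_row A. L2_set (\<lambda>j. norm (A $$ (i, j))) {..<dim_col A})"
  \<comment> \<open>The summand 1 keeps the constant positive for the zero matrix.\<close>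
  show "0 < C + 1"
    by (simp add: C_def sum_nonneg add_nonneg_pos)
  fix v :: "'a Matrix.vec"
  assume v: "v \<in> carrier_vec (dim_col A)"
  have row: "norm ((A *\<^sub>v v) $ i) \<le> L2_set (\<lambda>j. norm (A $$ (i, j))) {..<dim_col A} * l2_norm v"
    if i: "i < dim_row A" for i
  proof -
    have "norm ((A *\<^sub>v v) $ i) \<le> (\<Sum>j<dim_col A. \<bar>norm (A $$ (i, j))\<bar> * \<bar>norm (v $ j)\<bar>)"
      using i v
      by (auto simp: scalar_prod_def norm_mult atLeast0LessThan intro!: order_trans[OF norm_sum] sum_mono)
    also have "\<dots> \<le> L2_set (\<lambda>j. norm (A $$ (i, j))) {..<dim_col A} * l2_norm v"
      using L2_set_mult_ineq[of "\<lambda>j. norm (A $$ (i, j))" "\<lambda>j. norm (v $ j)" "{..<dim_col A}"] v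
      by (simp add: l2_norm_def)
    finally show ?thesis .
  qed
  have "l2_norm (A *\<^sub>v v) \<le> (\<Sum>i<dim_row A. norm ((A *\<^sub>v v) $ i))"
    using L2_set_le_sum_abs[of "\<lambda>i. norm ((A *\<^sub>v v) $ i)" "{..<dim_row A}"]
    by (simp add: l2_norm_def del: index_mult_mat_vec)
  also have "\<dots> \<le> C * l2_norm v"
    unfolding C_def sum_distrib_right using row by (auto intro!: sum_mono)
  also have "\<dots> \<le> (C + 1) * l2_norm v"
    by (simp add: distrib_right)
  finally show "l2_norm (A *\<^sub>v v) \<le> (C + 1) * l2_norm v" .
qed

lemma bdd_above_l2_norm_unit_ball:
  fixes A :: "'a :: real_normed_field mat"
  shows "bdd_above ((\<lambda>v. l2_norm (A *\<^sub>v v)) ` {v \<in> carrier_vec (dim_col A). l2_norm v \<le> 1})"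
proof -
  obtain C where C: "0 < C" "\<And>v. v \<in> carrier_vec (dim_col A) \<Longrightarrow> l2_norm (A *\<^sub>v v) \<le> C * l2_norm v"
    using l2_norm_mult_mat_vec_bounded[of A] by metis
  have "l2_norm (A *\<^sub>v v) \<le> C" if "v \<in> carrier_vec (dim_col A)" "l2_norm v \<le> 1" for v
    using order_trans[OF C(2)[OF that(1)] mult_left_mono[OF that(2), of C]] C(1) by simp
  then show ?thesis
    by (auto intro!: bdd_aboveI[of _ C])
qed

lemma spectral_norm_nonneg: "0 \<le> spectral_norm A"
proof -
  have "l2_norm (A *\<^sub>v 0\<^sub>v (dim_col A)) \<le> spectral_norm A"
    unfolding spectral_norm_def by (rule cSUP_upper[OF _ bdd_above_l2_norm_unit_ball]) simp
  then show ?thesis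
    using l2_norm_nonneg order_trans by blast
qed

text \<open>By homogeneity the unit ball can be traded for all vectors. Together with
  \<open>spectral_norm_nonneg\<close> this is the only access to the supremum in what
  follows.\<close>

lemma spectral_norm_le_iff:
  fixes A :: "'a :: real_normed_field mat"
  assumes "A \<in> carrier_mat m n" "0 \<le> c"
  shows "spectral_norm A \<le> c \<longleftrightarrow> (\<forall>v\<in>carrier_vec n. l2_norm (A *\<^sub>v v) \<le> c * l2_norm v)"
proof
  assume le: "spectral_norm A \<le> c"
  show "\<forall>v\<in>carrier_vec n. l2_norm (A *\<^sub>v v) \<le> c * l2_norm v"
  proof
    fix v :: "'a Matrix.vec"
    assume v: "v \<in> carrier_vec n"
    show "l2_norm (A *\<^sub>v v) \<le> c * l2_norm v"
    proof (cases "v = 0\<^sub>v n")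
      case True
      have "A *\<^sub>v 0\<^sub>v n = 0\<^sub>v m"
        using assms by auto
      then show ?thesis
        using True by simp
    next
      case False
      then have pos: "0 < l2_norm v"
        using l2_norm_pos_iff[OF v] by simp
      define w where "w = (of_real (inverse (l2_norm v)) :: 'a) \<cdot>\<^sub>v v"
      have "l2_norm (A *\<^sub>v w) \<le> spectral_norm A"
        unfolding spectral_norm_def
        by (rule cSUP_upper[OF _ bdd_above_l2_norm_unit_ball])
          (use assms v pos in \<open>auto simp: w_def l2_norm_smult simp flip: of_real_inverse\<close>)
      moreover have "A *\<^sub>v w = (of_real (inverse (l2_norm v)) :: 'a) \<cdot>\<^sub>v (A *\<^sub>v v)"
        unfolding w_def using assms v by (intro mult_mat_vec) auto
      ultimately have "inverse (l2_norm v) * l2_norm (A *\<^sub>v v) \<le> c"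
        using le pos by (simp add: l2_norm_smult del: of_real_inverse)
      then show ?thesis
        using pos by (simp add: field_simps)
    qed
  qed
next
  assume bound: "\<forall>v\<in>carrier_vec n. l2_norm (A *\<^sub>v v) \<le> c * l2_norm v"
  show "spectral_norm A \<le> c"
    unfolding spectral_norm_def
  proof (rule cSUP_least)
    show "{v \<in> carrier_vec (dim_col A). l2_norm v \<le> 1} \<noteq> {}"
      using zero_carrier_vec l2_norm_zero by fastforce
    fix v :: "'a Matrix.vec"
    assume "v \<in> {v \<in> carrier_vec (dim_col A). l2_norm v \<le> 1}"
    then have "v \<in> carrier_vec n" "l2_norm v \<le> 1"
      using assms by auto
    then show "l2_norm (A *\<^sub>v v) \<le> c"
      using bound mult_left_mono[of "l2_norm v" 1 c] assms(2) by fastforce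
  qed
qed

section \<open>Scalar products and adjoints\<close>

lemma complex_l2_norm_squared:
  fixes v :: "complex Matrix.vec"
  shows "complex_of_real ((l2_norm v)\<^sup>2) = v \<bullet>c v"
  by (simp add: l2_norm_def L2_set_def sum_nonneg scalar_prod_def complex_norm_square atLeast0LessThan
      del: of_real_power)

lemma real_l2_norm_squared:
  fixes v :: "real Matrix.vec"
  shows "(l2_norm v)\<^sup>2 = v \<bullet> v"
  by (simp add: l2_norm_def L2_set_def sum_nonneg scalar_prod_def power2_eq_square atLeast0LessThan)

lemma mat_adjoint_dim [simp]:
  "dim_row (mat_adjoint A) = dim_col A" "dim_col (mat_adjoint A) = dim_row A"
  by (simp_all add: mat_adjoint_def)

lemma mat_adjoint_carrier: "A \<in> carrier_mat m n \<Longrightarrow> mat_adjoint A \<in> carrier_mat n m"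
  by auto

lemma index_mat_adjoint [simp]:
  "i < dim_col A \<Longrightarrow> j < dim_row A \<Longrightarrow> mat_adjoint A $$ (i, j) = conjugate (A $$ (j, i))"
  by (simp add: mat_adjoint_def mat_of_rows_def)

lemma mat_adjoint_mult_vec:
  fixes A :: "complex mat"
  assumes "A \<in> carrier_mat m n" "x \<in> carrier_vec n" "y \<in> carrier_vec m"
  shows "(A *\<^sub>v x) \<bullet>c y = x \<bullet>c (mat_adjoint A *\<^sub>v y)"
proof -
  have "(A *\<^sub>v x) \<bullet>c y = (\<Sum>i<m. \<Sum>j<n. A $$ (i, j) * x $ j * cnj (y $ i))"
    using assms by (simp add: scalar_prod_def atLeast0LessThan sum_distrib_right)
  also have "\<dots> = (\<Sum>j<n. \<Sum>i<m. A $$ (i, j) * x $ j * cnj (y $ i))"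
    by (rule sum.swap)
  also have "\<dots> = x \<bullet>c (mat_adjoint A *\<^sub>v y)"
    using assms by (simp add: scalar_prod_def atLeast0LessThan sum_distrib_left mult_ac)
  finally show ?thesis .
qed

lemma mat_adjoint_complex_mat: "mat_adjoint (complex_mat A) = complex_mat (A\<^sup>T)"
  by (rule eq_matI) auto

lemma cscalar_prod_commute:
  fixes v w :: "complex Matrix.vec"
  assumes "v \<in> carrier_vec n" "w \<in> carrier_vec n"
  shows "w \<bullet>c v = cnj (v \<bullet>c w)"
  using assms by (simp add: scalar_prod_def mult.commute)

lemma cscalar_prod_smult_right:
  fixes v w :: "complex Matrix.vec"
  assumes "v \<in> carrier_vec n" "w \<in> carrier_vec n"
  shows "v \<bullet>c (a \<cdot>\<^sub>v w) = cnj a * (v \<bullet>c w)"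
  using assms by (simp add: conjugate_smult_vec)

lemma cscalar_prod_mult_mat_vec:
  fixes A :: "complex mat"
  assumes A: "A \<in> carrier_mat m n" and x: "x \<in> carrier_vec m" and y: "y \<in> carrier_vec n"
  shows "x \<bullet>c (A *\<^sub>v y) = (mat_adjoint A *\<^sub>v x) \<bullet>c y"
proof -
  have "x \<bullet>c (A *\<^sub>v y) = cnj ((A *\<^sub>v y) \<bullet>c x)"
    using A x y by (intro cscalar_prod_commute) auto
  also have "\<dots> = cnj (y \<bullet>c (mat_adjoint A *\<^sub>v x))"
    by (simp only: mat_adjoint_mult_vec[OF A y x])
  also have "\<dots> = (mat_adjoint A *\<^sub>v x) \<bullet>c y"
    using y mult_mat_vec_carrier[OF mat_adjoint_carrier[OF A] x]
    by (intro cscalar_prod_commute[symmetric]) auto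
  finally show ?thesis .
qed

lemma l2_norm_add_squared:
  fixes v w :: "complex Matrix.vec"
  assumes "v \<in> carrier_vec n" "w \<in> carrier_vec n"
  shows "(l2_norm (v + w))\<^sup>2 = (l2_norm v)\<^sup>2 + 2 * Re (v \<bullet>c w) + (l2_norm w)\<^sup>2"
proof -
  have sq: "(l2_norm u)\<^sup>2 = Re (u \<bullet>c u)" for u :: "complex Matrix.vec"
    using arg_cong[OF complex_l2_norm_squared[of u], of Re] by simp
  have "(v + w) \<bullet>c (v + w) = v \<bullet>c v + v \<bullet>c w + (w \<bullet>c v + w \<bullet>c w)"
    using assms
    by (simp add: conjugate_add_vec[of _ n] add_scalar_prod_distrib[of _ n] scalar_prod_add_distrib[of _ n])
  then show ?thesis
    using cscalar_prod_commute[OF assms] by (simp add: sq)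
qed

section \<open>The smallest eigenvalue of K^* K\<close>

text \<open>Serves twice: for K^* K - \<mu>, where an inverse is refuted, and for the Gram matrix
  V^* V, where both cases lead to a kernel vector of X.\<close>

lemma kernel_vec_or_inverse:
  fixes A :: "'a :: field mat"
  assumes A: "A \<in> carrier_mat n n"
  obtains (kernel) v where "v \<in> carrier_vec n" "v \<noteq> 0\<^sub>v n" "A *\<^sub>v v = 0\<^sub>v n"
  | (inverse) B where "B \<in> carrier_mat n n" "B * A = 1\<^sub>m n" "A * B = 1\<^sub>m n"
proof (cases "det A = 0")
  case True
  then show ?thesis
    using det_0_iff_vec_prod_zero_field[OF A] kernel by blast
next
  case False
  then show ?thesis
    using det_non_zero_imp_unit[OF A, of "()"] inverse by (auto simp: Units_def ring_mat_def)
qed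

text \<open>With \<open>\<mu>\<close> the infimum of the Rayleigh quotient, \<open>H = K\<^sup>* K - \<mu>\<close> is positive
  semidefinite, so testing with \<open>x - s H x\<close> bounds \<open>\<parallel>H x\<parallel>\<^sup>2\<close> by a multiple of the quadratic form
  of \<open>H\<close>. Were \<open>H\<close> invertible, that form would be bounded away from 0 on unit vectors; hence no
  compactness is needed.\<close>

lemma smallest_eigenvalue_adjoint_mult:
  fixes K :: "complex mat"
  assumes K: "K \<in> carrier_mat m n" and n: "0 < n"
  obtains \<mu> w where "w \<in> carrier_vec n" "w \<noteq> 0\<^sub>v n"
    "mat_adjoint K *\<^sub>v (K *\<^sub>v w) = complex_of_real \<mu> \<cdot>\<^sub>v w"
    "\<And>x. x \<in> carrier_vec n \<Longrightarrow> \<mu> * (l2_norm x)\<^sup>2 \<le> (l2_norm (K *\<^sub>v x))\<^sup>2"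
proof -
  define S where "S = (\<lambda>x. (l2_norm (K *\<^sub>v x))\<^sup>2) ` {x \<in> carrier_vec n. l2_norm x = 1}"
  define \<mu> where "\<mu> = Inf S"
  have "l2_norm (unit_vec n 0 :: complex Matrix.vec) = 1"
  proof -
    have "(l2_norm (unit_vec n 0 :: complex Matrix.vec))\<^sup>2 = 1"
      using n arg_cong[OF complex_l2_norm_squared[of "unit_vec n 0"], of Re]
      by (simp add: scalar_prod_left_unit)
    then show ?thesis
      by (simp add: power2_eq_1_iff order_trans[OF _ l2_norm_nonneg])
        (metis l2_norm_nonneg neg_0_le_iff_le not_one_le_zero)
  qed
  then have ne: "S \<noteq> {}"
    unfolding S_def using unit_vec_carrier[of n 0] by blast
  have bdd: "bdd_below S"
    by (auto simp: S_def intro!: bdd_belowI[of _ 0])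
  have \<mu>0: "0 \<le> \<mu>"
    unfolding \<mu>_def by (rule cInf_greatest[OF ne]) (auto simp: S_def)
  have least: "\<mu> * (l2_norm x)\<^sup>2 \<le> (l2_norm (K *\<^sub>v x))\<^sup>2" if x: "x \<in> carrier_vec n" for x
  proof (cases "x = 0\<^sub>v n")
    case True
    then show ?thesis by simp
  next
    case False
    then have pos: "0 < l2_norm x"
      using l2_norm_pos_iff[OF x] by simp
    define u where "u = complex_of_real (1 / l2_norm x) \<cdot>\<^sub>v x"
    have "(l2_norm (K *\<^sub>v u))\<^sup>2 \<in> S"
      unfolding S_def using pos x by (auto simp: u_def l2_norm_smult norm_divide)
    then have "\<mu> \<le> (l2_norm (K *\<^sub>v u))\<^sup>2"
      unfolding \<mu>_def by (rule cInf_lower[OF _ bdd])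
    moreover have "K *\<^sub>v u = complex_of_real (1 / l2_norm x) \<cdot>\<^sub>v (K *\<^sub>v x)"
      unfolding u_def using K x by (rule mult_mat_vec)
    ultimately show ?thesis
      using pos by (simp add: l2_norm_smult norm_divide power_divide field_simps)
  qed
  define H where "H = mat_adjoint K * K - complex_of_real \<mu> \<cdot>\<^sub>m 1\<^sub>m n"
  have Kadj: "mat_adjoint K \<in> carrier_mat n m"
    using K by (rule mat_adjoint_carrier)
  have H: "H \<in> carrier_mat n n"
    unfolding H_def by (intro minus_carrier_mat) simp
  have Hx: "H *\<^sub>v x = mat_adjoint K *\<^sub>v (K *\<^sub>v x) - complex_of_real \<mu> \<cdot>\<^sub>v x"
    if x: "x \<in> carrier_vec n" for x
    using x K Kadj unfolding H_def
    by (subst minus_mult_distrib_mat_vec[where nr = n and nc = n])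
      (auto simp: assoc_mult_mat_vec[where n\<^sub>1 = n and n\<^sub>2 = m and n\<^sub>3 = n] smult_mat_mult_vec)
  from H show ?thesis
  proof (cases rule: kernel_vec_or_inverse)
    case (kernel w)
    have "mat_adjoint K *\<^sub>v (K *\<^sub>v w) = complex_of_real \<mu> \<cdot>\<^sub>v w"
      using kernel(3) Hx[OF kernel(1)] K Kadj kernel(1)
      by (auto simp: vec_eq_iff)
    then show ?thesis
      using that kernel least by blast
  next
    case (inverse R)
    obtain C where C: "0 < C" "\<And>v. v \<in> carrier_vec n \<Longrightarrow> l2_norm (K *\<^sub>v v) \<le> C * l2_norm v"
      using l2_norm_mult_mat_vec_bounded[of K] K by (metis carrier_matD(2))
    obtain D where D: "0 < D" "\<And>v. v \<in> carrier_vec n \<Longrightarrow> l2_norm (R *\<^sub>v v) \<le> D * l2_norm v"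
      using l2_norm_mult_mat_vec_bounded[of R] inverse(1) by (metis carrier_matD(2))
    \<comment> \<open>A gap valid on all of \<open>S\<close> contradicts
      \<open>\<mu> = Inf S\<close>. Here \<open>C\<close> bounds K and \<open>D\<close> bounds the
      inverse \<open>R\<close> of \<open>H\<close>.\<close>
    have "\<mu> + 1 / (C\<^sup>2 * D\<^sup>2) \<le> t" if tS: "t \<in> S" for t
    proof -
      obtain x where x: "x \<in> carrier_vec n" "l2_norm x = 1" and t: "t = (l2_norm (K *\<^sub>v x))\<^sup>2"
        using tS by (auto simp: S_def)
      define y where "y = H *\<^sub>v x"
      have y: "y \<in> carrier_vec n"
        using H x by (simp add: y_def)
      \<comment> \<open>A step of length s along -y gains 2 s |y|^2 to first order and loses at most
        s^2 C^2 |y|^2; for s = 1 / C^2 the loss is at most half the gain.\<close>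
      define s where "s = 1 / C\<^sup>2"
      define y' where "y' = complex_of_real (- s) \<cdot>\<^sub>v y"
      have y': "y' \<in> carrier_vec n" and Ky': "K *\<^sub>v y' = complex_of_real (- s) \<cdot>\<^sub>v (K *\<^sub>v y)"
        unfolding y'_def using y K mult_mat_vec by auto
      \<comment> \<open>Because y = K^* K x - \<mu> x, the mixed term of the form of
        \<open>H\<close> at x and y is |y|^2 itself.\<close>
      have "(l2_norm y)\<^sup>2 = Re (y \<bullet>c y)"
        using arg_cong[OF complex_l2_norm_squared[of y], of Re] by simp
      also have "y \<bullet>c y = (mat_adjoint K *\<^sub>v (K *\<^sub>v x)) \<bullet>c y - complex_of_real \<mu> * (x \<bullet>c y)"
      proof -
        have "(mat_adjoint K *\<^sub>v (K *\<^sub>v x) - complex_of_real \<mu> \<cdot>\<^sub>v x) \<bullet>c y =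
            (mat_adjoint K *\<^sub>v (K *\<^sub>v x)) \<bullet>c y - (complex_of_real \<mu> \<cdot>\<^sub>v x) \<bullet>c y"
          using x y K Kadj by (intro minus_scalar_prod_distrib[of _ n]) auto
        then show ?thesis
          using Hx[OF x(1)] x y by (simp add: y_def[symmetric])
      qed
      also have "(mat_adjoint K *\<^sub>v (K *\<^sub>v x)) \<bullet>c y = (K *\<^sub>v x) \<bullet>c (K *\<^sub>v y)"
        using cscalar_prod_commute[of y n "mat_adjoint K *\<^sub>v (K *\<^sub>v x)"]
          cscalar_prod_commute[of "K *\<^sub>v y" m "K *\<^sub>v x"]
          mat_adjoint_mult_vec[OF K y, of "K *\<^sub>v x"] x y K Kadj by simp
      finally have cross: "Re ((K *\<^sub>v x) \<bullet>c (K *\<^sub>v y)) - \<mu> * Re (x \<bullet>c y) = (l2_norm y)\<^sup>2"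
        by simp
      have "\<mu> * (l2_norm (x + y'))\<^sup>2 \<le> (l2_norm (K *\<^sub>v (x + y')))\<^sup>2"
        using least x y' by simp
      also have "K *\<^sub>v (x + y') = K *\<^sub>v x + K *\<^sub>v y'"
        using K x y' by (simp add: mult_add_distrib_mat_vec)
      also have "(l2_norm \<dots>)\<^sup>2 = t - 2 * s * Re ((K *\<^sub>v x) \<bullet>c (K *\<^sub>v y)) + s\<^sup>2 * (l2_norm (K *\<^sub>v y))\<^sup>2"
        unfolding Ky' t using K x y
        by (subst l2_norm_add_squared[where n = m])
          (auto simp: cscalar_prod_smult_right[where n = m] l2_norm_smult power_mult_distrib)
      also have "(l2_norm (x + y'))\<^sup>2 = 1 - 2 * s * Re (x \<bullet>c y) + s\<^sup>2 * (l2_norm y)\<^sup>2"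
        unfolding y'_def using x y
        by (subst l2_norm_add_squared[where n = n])
          (auto simp: cscalar_prod_smult_right[where n = n] l2_norm_smult power_mult_distrib)
      finally have "\<mu> + \<mu> * s\<^sup>2 * (l2_norm y)\<^sup>2 + 2 * s * (l2_norm y)\<^sup>2 \<le> t + s\<^sup>2 * (l2_norm (K *\<^sub>v y))\<^sup>2"
        unfolding cross[symmetric] by (simp add: algebra_simps)
      moreover have "(l2_norm (K *\<^sub>v y))\<^sup>2 \<le> C\<^sup>2 * (l2_norm y)\<^sup>2"
        using power_mono[OF C(2)[OF y], of 2] by (simp add: power_mult_distrib)
      then have "s\<^sup>2 * (l2_norm (K *\<^sub>v y))\<^sup>2 \<le> s * (l2_norm y)\<^sup>2"
        using C(1) by (simp add: s_def power2_eq_square field_simps)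
      moreover have "0 \<le> \<mu> * s\<^sup>2 * (l2_norm y)\<^sup>2"
        using \<mu>0 by simp
      ultimately have "\<mu> + s * (l2_norm y)\<^sup>2 \<le> t"
        by linarith
      moreover have "R *\<^sub>v y = x"
        unfolding y_def using inverse x H by (simp flip: assoc_mult_mat_vec)
      then have "1 \<le> D * l2_norm y"
        using D(2)[OF y] x by simp
      then have "1 \<le> D\<^sup>2 * (l2_norm y)\<^sup>2"
        using power_mono[of 1 "D * l2_norm y" 2] by (simp add: power_mult_distrib)
      then have "1 / D\<^sup>2 \<le> (l2_norm y)\<^sup>2"
        using D(1) by (simp add: field_simps)
      then have "s * (1 / D\<^sup>2) \<le> s * (l2_norm y)\<^sup>2"
        by (rule mult_left_mono) (simp add: s_def)
      ultimately show ?thesis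
        by (simp add: s_def)
    qed
    then have "\<mu> + 1 / (C\<^sup>2 * D\<^sup>2) \<le> \<mu>"
      unfolding \<mu>_def by (intro cInf_greatest[OF ne]) (simp add: \<mu>_def)
    moreover have "0 < 1 / (C\<^sup>2 * D\<^sup>2)"
      using C(1) D(1) by simp
    ultimately show ?thesis
      by linarith
  qed
qed

section \<open>The block matrix and its factorisation\<close>

lemma shift_minus_product_mult_vec:
  fixes W :: "'a :: comm_ring_1 mat"
  assumes W: "W \<in> carrier_mat n m" and Y: "Y \<in> carrier_mat m n" and v: "v \<in> carrier_vec n"
  shows "(q \<cdot>\<^sub>m 1\<^sub>m n - s \<cdot>\<^sub>m (W * Y)) *\<^sub>v v = q \<cdot>\<^sub>v v - s \<cdot>\<^sub>v (W *\<^sub>v (Y *\<^sub>v v))"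
proof -
  have WY: "W * Y \<in> carrier_mat n n"
    using W Y by simp
  have "(q \<cdot>\<^sub>m 1\<^sub>m n - s \<cdot>\<^sub>m (W * Y)) *\<^sub>v v = (q \<cdot>\<^sub>m 1\<^sub>m n) *\<^sub>v v - (s \<cdot>\<^sub>m (W * Y)) *\<^sub>v v"
    using WY v by (intro minus_mult_distrib_mat_vec[where nr = n and nc = n]) auto
  then show ?thesis
    using W Y v carrier_matD[OF WY] by (simp add: smult_mat_mult_vec assoc_mult_mat_vec[OF W Y v])
qed

text \<open>The identity calM = |z|^2 I + Y X on vectors: \<open>x\<close> is X (a, b), and the
  appended pair in the last summand is Y x. The term |z|^2 U^* U in the upper right block arises
  when -z U^* meets the summand -conj(z) U b.\<close>

lemma calM_mult_append_vec:
  fixes U V :: "complex mat" and z :: complex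
  assumes U: "U \<in> carrier_mat d l" and V: "V \<in> carrier_mat d l"
    and a: "a \<in> carrier_vec l" and b: "b \<in> carrier_vec l"
  defines "x \<equiv> V *\<^sub>v a + V *\<^sub>v (mat_adjoint U *\<^sub>v (U *\<^sub>v b)) - cnj z \<cdot>\<^sub>v (U *\<^sub>v b)"
  shows "calM U V z *\<^sub>v (a @\<^sub>v b) = complex_of_real ((cmod z)\<^sup>2) \<cdot>\<^sub>v (a @\<^sub>v b) +
    ((- z) \<cdot>\<^sub>v (mat_adjoint U *\<^sub>v x) @\<^sub>v mat_adjoint V *\<^sub>v x)"
proof -
  define Us Vs where "Us = mat_adjoint U" and "Vs = mat_adjoint V"
  define q where "q = complex_of_real ((cmod z)\<^sup>2)"
  define c where "c = Us *\<^sub>v (U *\<^sub>v b)"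
  define B where "B = q \<cdot>\<^sub>m 1\<^sub>m l - z \<cdot>\<^sub>m (Us * V)"
  have Us: "Us \<in> carrier_mat l d" and Vs: "Vs \<in> carrier_mat l d"
    using U V by (simp_all add: Us_def Vs_def mat_adjoint_carrier)
  have c: "c \<in> carrier_vec l"
    using U Us b by (simp add: c_def)
  have UU: "Us * U \<in> carrier_mat l l" and UV: "Us * V \<in> carrier_mat l l"
    and VV: "Vs * V \<in> carrier_mat l l" and VU: "Vs * U \<in> carrier_mat l l"
    using U V Us Vs by auto
  have B: "B \<in> carrier_mat l l"
    using UV by (simp add: B_def minus_carrier_mat)
  have UUb: "(Us * U) *\<^sub>v b = c"
    using Us U b by (simp add: c_def)
  have Bv: "B *\<^sub>v v = q \<cdot>\<^sub>v v - z \<cdot>\<^sub>v (Us *\<^sub>v (V *\<^sub>v v))" if v: "v \<in> carrier_vec l" for v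
    unfolding B_def by (rule shift_minus_product_mult_vec[OF Us V v])
  have BUU: "(B * (Us * U)) *\<^sub>v b = q \<cdot>\<^sub>v c - z \<cdot>\<^sub>v (Us *\<^sub>v (V *\<^sub>v c))"
    by (simp add: assoc_mult_mat_vec[OF B UU b] UUb Bv[OF c])
  have VVv: "(Vs * V) *\<^sub>v v = Vs *\<^sub>v (V *\<^sub>v v)" if "v \<in> carrier_vec l" for v
    using Vs V that by simp
  have D: "(q \<cdot>\<^sub>m 1\<^sub>m l - cnj z \<cdot>\<^sub>m (Vs * U) + Vs * V * (Us * U)) *\<^sub>v b =
      q \<cdot>\<^sub>v b - cnj z \<cdot>\<^sub>v (Vs *\<^sub>v (U *\<^sub>v b)) + Vs *\<^sub>v (V *\<^sub>v c)"
  proof -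
    have "(q \<cdot>\<^sub>m 1\<^sub>m l - cnj z \<cdot>\<^sub>m (Vs * U) + Vs * V * (Us * U)) *\<^sub>v b =
        (q \<cdot>\<^sub>m 1\<^sub>m l - cnj z \<cdot>\<^sub>m (Vs * U)) *\<^sub>v b + (Vs * V * (Us * U)) *\<^sub>v b"
      using b VU mult_carrier_mat[OF VV UU]
      by (intro add_mult_distrib_mat_vec[where nr = l and nc = l]) (simp_all add: minus_carrier_mat)
    then show ?thesis
      by (simp add: shift_minus_product_mult_vec[OF Vs U b] assoc_mult_mat_vec[OF VV UU b] UUb VVv[OF c])
  qed
  have lin: "W *\<^sub>v x = W *\<^sub>v (V *\<^sub>v a) + W *\<^sub>v (V *\<^sub>v c) - cnj z \<cdot>\<^sub>v (W *\<^sub>v (U *\<^sub>v b))"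
    if W: "W \<in> carrier_mat l d" for W
    unfolding x_def Us_def[symmetric] c_def[symmetric] using W U V a b c
    by (subst mult_minus_distrib_mat_vec[OF W], auto)
      (subst mult_add_distrib_mat_vec[OF W], auto)
  have "calM U V z *\<^sub>v (a @\<^sub>v b) =
      (B *\<^sub>v a + (B * (Us * U)) *\<^sub>v b) @\<^sub>v ((Vs * V) *\<^sub>v a +
        (q \<cdot>\<^sub>m 1\<^sub>m l - cnj z \<cdot>\<^sub>m (Vs * U) + Vs * V * (Us * U)) *\<^sub>v b)"
    unfolding calM_def Let_def Us_def[symmetric] Vs_def[symmetric] q_def[symmetric] carrier_matD(2)[OF U]
      B_def[symmetric]
    by (intro four_block_mat_mult_vec[OF B mult_carrier_mat[OF B UU] VV _ a b] add_carrier_mat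
        mult_carrier_mat[OF VV UU])
  also have "\<dots> = (q \<cdot>\<^sub>v a - z \<cdot>\<^sub>v (Us *\<^sub>v (V *\<^sub>v a)) + (q \<cdot>\<^sub>v c - z \<cdot>\<^sub>v (Us *\<^sub>v (V *\<^sub>v c)))) @\<^sub>v
      (Vs *\<^sub>v (V *\<^sub>v a) + (q \<cdot>\<^sub>v b - cnj z \<cdot>\<^sub>v (Vs *\<^sub>v (U *\<^sub>v b)) + Vs *\<^sub>v (V *\<^sub>v c)))"
    by (simp add: Bv[OF a] BUU VVv[OF a] D)
  also have "\<dots> = q \<cdot>\<^sub>v (a @\<^sub>v b) + ((- z) \<cdot>\<^sub>v (Us *\<^sub>v x) @\<^sub>v Vs *\<^sub>v x)"
    unfolding lin[OF Us] lin[OF Vs] c_def[symmetric]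
    using U V Us Vs a b c
    by (intro eq_vecI) (auto simp: q_def complex_norm_square algebra_simps c_def[symmetric]
        simp del: of_real_power index_mult_mat_vec)
  finally show ?thesis
    unfolding Us_def Vs_def q_def .
qed

lemma low_rank_shift_mult_vec:
  fixes U V :: "complex mat"
  assumes "U \<in> carrier_mat d l" "V \<in> carrier_mat d l" "x \<in> carrier_vec d"
  shows "(U * mat_adjoint V - z \<cdot>\<^sub>m 1\<^sub>m d) *\<^sub>v x = U *\<^sub>v (mat_adjoint V *\<^sub>v x) - z \<cdot>\<^sub>v x"
  using assms mat_adjoint_carrier[OF assms(2)]
  by (subst minus_mult_distrib_mat_vec[where nr = d and nc = d])
    (auto simp: smult_mat_mult_vec assoc_mult_mat_vec[OF assms(1) mat_adjoint_carrier[OF assms(2)] assms(3)])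

text \<open>After this exchange of the factors, \<open>low_rank_shift_mult_vec\<close> evaluates the
  adjoint as well.\<close>

lemma mat_adjoint_low_rank_shift:
  fixes U V :: "complex mat"
  assumes "U \<in> carrier_mat d l" "V \<in> carrier_mat d l"
  shows "mat_adjoint (U * mat_adjoint V - z \<cdot>\<^sub>m 1\<^sub>m d) = V * mat_adjoint U - cnj z \<cdot>\<^sub>m 1\<^sub>m d"
  using assms by (intro eq_matI) (auto simp: scalar_prod_def mult.commute)

text \<open>The companion identity K^* K = |z|^2 I + X Y, with (a, b) = Y x. When the product is
  expanded, V U^* applied to -z x becomes V a, and conj(z) z x supplies the multiple of x.\<close>

lemma low_rank_shift_normal_mult_vec:
  fixes U V :: "complex mat" and z :: complex
  assumes U: "U \<in> carrier_mat d l" and V: "V \<in> carrier_mat d l" and x: "x \<in> carrier_vec d"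
  defines "K \<equiv> U * mat_adjoint V - z \<cdot>\<^sub>m 1\<^sub>m d"
    and "a \<equiv> (- z) \<cdot>\<^sub>v (mat_adjoint U *\<^sub>v x)" and "b \<equiv> mat_adjoint V *\<^sub>v x"
  shows "mat_adjoint K *\<^sub>v (K *\<^sub>v x) = complex_of_real ((cmod z)\<^sup>2) \<cdot>\<^sub>v x +
    (V *\<^sub>v a + V *\<^sub>v (mat_adjoint U *\<^sub>v (U *\<^sub>v b)) - cnj z \<cdot>\<^sub>v (U *\<^sub>v b))"
proof -
  define Us where "Us = mat_adjoint U"
  have Us: "Us \<in> carrier_mat l d" and b: "b \<in> carrier_vec l"
    using U mult_mat_vec_carrier[OF mat_adjoint_carrier[OF V] x] by (simp_all add: Us_def b_def mat_adjoint_carrier)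
  have Kx: "K *\<^sub>v x = U *\<^sub>v b - z \<cdot>\<^sub>v x"
    unfolding K_def b_def using U V x by (rule low_rank_shift_mult_vec)
  have "mat_adjoint K *\<^sub>v (K *\<^sub>v x) = V *\<^sub>v (Us *\<^sub>v (U *\<^sub>v b - z \<cdot>\<^sub>v x)) - cnj z \<cdot>\<^sub>v (U *\<^sub>v b - z \<cdot>\<^sub>v x)"
    unfolding Kx unfolding K_def mat_adjoint_low_rank_shift[OF U V] Us_def
    using U V b x by (intro low_rank_shift_mult_vec) auto
  also have "Us *\<^sub>v (U *\<^sub>v b - z \<cdot>\<^sub>v x) = Us *\<^sub>v (U *\<^sub>v b) - z \<cdot>\<^sub>v (Us *\<^sub>v x)"
    using U Us b x mult_mat_vec[OF Us x] by (subst mult_minus_distrib_mat_vec[OF Us]) auto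
  also have "V *\<^sub>v \<dots> = V *\<^sub>v (Us *\<^sub>v (U *\<^sub>v b)) - z \<cdot>\<^sub>v (V *\<^sub>v (Us *\<^sub>v x))"
    using U V Us b x mult_mat_vec[OF V, of "Us *\<^sub>v x"] by (subst mult_minus_distrib_mat_vec[OF V]) auto
  finally show ?thesis
    unfolding a_def Us_def[symmetric] using U V Us b x
    by (subst mult_mat_vec[OF V]) (auto intro!: eq_vecI simp: complex_norm_square algebra_simps
        simp del: of_real_power index_mult_mat_vec)
qed

text \<open>The case in which \<open>\<bar>z\<bar>\<^sup>2\<close> itself is the smallest eigenvalue of \<open>K\<^sup>* K\<close>. If \<open>V\<^sup>* V\<close> is
  invertible, the component \<open>w\<close> of \<open>U b\<close> orthogonal to the range of \<open>V\<close> satisfies \<open>U\<^sup>* w = 0\<close>, as a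
  first-order perturbation of \<open>w\<close> within that range would otherwise lower the quotient; so \<open>w = 0\<close>.\<close>

lemma degenerate_kernel_vec:
  fixes U V :: "complex mat" and z :: complex
  assumes U: "U \<in> carrier_mat d l" and V: "V \<in> carrier_mat d l" and l: "0 < l"
    and least: "\<And>x. x \<in> carrier_vec d \<Longrightarrow>
      (cmod z)\<^sup>2 * (l2_norm x)\<^sup>2 \<le> (l2_norm ((U * mat_adjoint V - z \<cdot>\<^sub>m 1\<^sub>m d) *\<^sub>v x))\<^sup>2"
  obtains a b where "a \<in> carrier_vec l" "b \<in> carrier_vec l" "a \<noteq> 0\<^sub>v l \<or> b \<noteq> 0\<^sub>v l"
    "V *\<^sub>v a + V *\<^sub>v (mat_adjoint U *\<^sub>v (U *\<^sub>v b)) - cnj z \<cdot>\<^sub>v (U *\<^sub>v b) = 0\<^sub>v d"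
proof -
  define Us Vs where "Us = mat_adjoint U" and "Vs = mat_adjoint V"
  have Us: "Us \<in> carrier_mat l d" and Vs: "Vs \<in> carrier_mat l d"
    using U V by (simp_all add: Us_def Vs_def mat_adjoint_carrier)
  have VV: "Vs * V \<in> carrier_mat l l"
    using V Vs by simp
  from VV show ?thesis
  proof (cases rule: kernel_vec_or_inverse)
    case (kernel a)
    \<comment> \<open>Here X (a, 0) = V a, so it is enough that V vanishes on a kernel vector of the
      Gram matrix.\<close>
    have "(V *\<^sub>v a) \<bullet>c (V *\<^sub>v a) = a \<bullet>c ((Vs * V) *\<^sub>v a)"
      using V Vs kernel(1) by (simp add: mat_adjoint_mult_vec[OF V] Vs_def[symmetric])
    then have "V *\<^sub>v a = 0\<^sub>v d"
      using kernel V conjugate_square_eq_0_vec[of "V *\<^sub>v a" d] by simp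
    then show ?thesis
      using that[of a "0\<^sub>v l"] kernel
        mult_mat_zero_vec[OF U] mult_mat_zero_vec[OF V] mult_mat_zero_vec[OF Us]
      unfolding Us_def[symmetric] by (simp add: smult_zero_vec)
  next
    case (inverse G)
    \<comment> \<open>The choice of \<open>b\<close> is free as long as it is nonzero;
      \<open>a\<close> is adapted to it at the end.\<close>
    define b where "b = (unit_vec l 0 :: complex Matrix.vec)"
    have b: "b \<in> carrier_vec l" "b \<noteq> 0\<^sub>v l"
      using l by (auto simp: b_def)
    define Ub where "Ub = U *\<^sub>v b"
    have Ub: "Ub \<in> carrier_vec d"
      using U b by (simp add: Ub_def)
    have VsVG: "Vs *\<^sub>v (V *\<^sub>v (G *\<^sub>v v)) = v" if v: "v \<in> carrier_vec l" for v
    proof -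
      have "Vs *\<^sub>v (V *\<^sub>v (G *\<^sub>v v)) = (Vs * V) *\<^sub>v (G *\<^sub>v v)"
        using Vs V inverse(1) v by simp
      also have "\<dots> = ((Vs * V) * G) *\<^sub>v v"
        using VV inverse(1) v by (simp only: assoc_mult_mat_vec)
      finally show ?thesis
        using inverse(3) v by simp
    qed
    \<comment> \<open>For z = 0 the term conj(z) U b disappears and \<open>c\<close> is arbitrary;
      otherwise U b has to lie in the range of V.\<close>
    obtain c where c: "c \<in> carrier_vec l" and Vc: "z = 0 \<or> Ub = V *\<^sub>v c"
    proof (cases "z = 0")
      case True
      then show ?thesis
        using that b by blast
    next
      case z: False
      \<comment> \<open>Normal equations: V c is the orthogonal projection of U b onto the range of
        V, and \<open>w\<close> is the residual.\<close>
      define c where "c = G *\<^sub>v (Vs *\<^sub>v Ub)"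
      define w where "w = Ub - V *\<^sub>v c"
      define g where "g = Us *\<^sub>v w"
      define p where "p = U *\<^sub>v g"
      \<comment> \<open>Lies in the range of V and satisfies V^* h = g, so that V^* maps w + s z h
        to s z g.\<close>
      define h where "h = V *\<^sub>v (G *\<^sub>v g)"
      have c: "c \<in> carrier_vec l"
        using inverse(1) Vs Ub by (simp add: c_def)
      have w: "w \<in> carrier_vec d"
        using Ub V c by (simp add: w_def)
      have g: "g \<in> carrier_vec l"
        using Us w by (simp add: g_def)
      have p: "p \<in> carrier_vec d"
        using U g by (simp add: p_def)
      have h: "h \<in> carrier_vec d"
        using V inverse(1) g by (simp add: h_def)
      have Vsw: "Vs *\<^sub>v w = 0\<^sub>v l"
        unfolding w_def using Vs V Ub c VsVG[of "Vs *\<^sub>v Ub"]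
        by (subst mult_minus_distrib_mat_vec[OF Vs]) (auto simp: c_def)
      have wp: "w \<bullet>c p = complex_of_real ((l2_norm g)\<^sup>2)"
        unfolding p_def complex_l2_norm_squared cscalar_prod_mult_mat_vec[OF U w g] by (simp add: g_def Us_def)
      define T where "T = (l2_norm p)\<^sup>2 - 2 * Re (z * (h \<bullet>c p))"
      \<comment> \<open>For x = w + s z h one has K x = -z (x - s p). Minimality divided by |z|^2
        leaves 2 Re <x, p> \<le> s |p|^2, where <w, p> = |g|^2 does not depend on s and everything
        else is of order s.\<close>
      have bound: "2 * (l2_norm g)\<^sup>2 \<le> s * T" if s: "0 < s" for s :: real
      proof -
        define x where "x = w + (complex_of_real s * z) \<cdot>\<^sub>v h"
        have x: "x \<in> carrier_vec d"
          using w h by (simp add: x_def)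
        have "Vs *\<^sub>v x = (complex_of_real s * z) \<cdot>\<^sub>v g"
          unfolding x_def using Vs w h Vsw VsVG[OF g] mult_mat_vec[OF Vs h] g
          by (subst mult_add_distrib_mat_vec[OF Vs]) (auto simp: h_def)
        then have "(U * mat_adjoint V - z \<cdot>\<^sub>m 1\<^sub>m d) *\<^sub>v x = (complex_of_real s * z) \<cdot>\<^sub>v p - z \<cdot>\<^sub>v x"
          unfolding low_rank_shift_mult_vec[OF U V x] by (simp add: Vs_def p_def mult_mat_vec[OF U g])
        also have "\<dots> = (- z) \<cdot>\<^sub>v (x + complex_of_real (- s) \<cdot>\<^sub>v p)"
          using p x by (intro eq_vecI) (auto simp: algebra_simps)
        finally have "(cmod z)\<^sup>2 * (l2_norm x)\<^sup>2 \<le> (cmod z)\<^sup>2 * (l2_norm (x + complex_of_real (- s) \<cdot>\<^sub>v p))\<^sup>2"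
          using least[OF x] by (simp add: l2_norm_smult power_mult_distrib)
        then have "(l2_norm x)\<^sup>2 \<le> (l2_norm (x + complex_of_real (- s) \<cdot>\<^sub>v p))\<^sup>2"
          using z by simp
        also have "\<dots> = (l2_norm x)\<^sup>2 - 2 * s * Re (x \<bullet>c p) + s\<^sup>2 * (l2_norm p)\<^sup>2"
          using x p by (subst l2_norm_add_squared[where n = d])
            (auto simp: cscalar_prod_smult_right[where n = d] l2_norm_smult power_mult_distrib)
        finally have "s * (2 * Re (x \<bullet>c p)) \<le> s * (s * (l2_norm p)\<^sup>2)"
          by (simp add: power2_eq_square algebra_simps)
        then have "2 * Re (x \<bullet>c p) \<le> s * (l2_norm p)\<^sup>2"
          using s by simp
        moreover have "x \<bullet>c p = w \<bullet>c p + (complex_of_real s * z) * (h \<bullet>c p)"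
          unfolding x_def using w h p by (subst add_scalar_prod_distrib[where n = d]) auto
        ultimately show ?thesis
          by (simp add: wp T_def algebra_simps)
      qed
      have "(l2_norm g)\<^sup>2 \<le> 0"
      proof (rule ccontr)
        assume "\<not> (l2_norm g)\<^sup>2 \<le> 0"
        then have pos: "0 < (l2_norm g)\<^sup>2" by simp
        then have "0 < T"
          using bound[of 1] by linarith
        \<comment> \<open>The chosen s turns the bound into 2 |g|^2 \<le> |g|^2.\<close>
        then show False
          using pos bound[of "(l2_norm g)\<^sup>2 / T"] by simp
      qed
      then have g0: "g = 0\<^sub>v l"
        using l2_norm_eq_0_iff[OF g] by simp
      \<comment> \<open>The residual lies in the sum of the ranges of U and V, and it is orthogonal
        to both since U^* w = g = 0 and V^* w = 0.\<close>
      have "w \<bullet>c w = w \<bullet>c Ub - w \<bullet>c (V *\<^sub>v c)"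
      proof -
        have "conjugate w = conjugate Ub - conjugate (V *\<^sub>v c)"
          unfolding w_def using Ub V c by (intro eq_vecI) auto
        then show ?thesis
          using w Ub V c by (simp add: scalar_prod_minus_distrib[of _ d])
      qed
      also have "\<dots> = 0"
        unfolding Ub_def using g0 Vsw b c
        by (simp add: cscalar_prod_mult_mat_vec[OF U w b(1)] cscalar_prod_mult_mat_vec[OF V w c]
            g_def Us_def Vs_def)
      finally have "w = 0\<^sub>v d"
        using conjugate_square_eq_0_vec[OF w] by simp
      then have "Ub = V *\<^sub>v c"
        using Ub V c unfolding w_def by (auto simp: vec_eq_iff simp del: index_mult_mat_vec)
      then show ?thesis
        using that[OF c] by simp
    qed
    \<comment> \<open>With this \<open>a\<close> the terms V U^* U b cancel; what remains is conj(z)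
      times V c - U b, which is zero in either case.\<close>
    define a where "a = cnj z \<cdot>\<^sub>v c - Us *\<^sub>v Ub"
    have a: "a \<in> carrier_vec l"
      using c Us Ub by (simp add: a_def)
    have "V *\<^sub>v a = cnj z \<cdot>\<^sub>v (V *\<^sub>v c) - V *\<^sub>v (Us *\<^sub>v Ub)"
      unfolding a_def using V c Us Ub mult_mat_vec[OF V c]
      by (subst mult_minus_distrib_mat_vec[OF V]) auto
    then have "V *\<^sub>v a + V *\<^sub>v (Us *\<^sub>v Ub) - cnj z \<cdot>\<^sub>v Ub = 0\<^sub>v d"
      using Vc V c Us Ub by (auto intro!: eq_vecI simp del: index_mult_mat_vec)
    then show ?thesis
      using that[of a b] a b unfolding Us_def Ub_def by blast
  qed
qed

lemma eigenvalue_calM: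
  fixes U V :: "complex mat" and z :: complex
  assumes U: "U \<in> carrier_mat d l" and V: "V \<in> carrier_mat d l" and l: "0 < l"
    and w: "w \<in> carrier_vec d" "w \<noteq> 0\<^sub>v d"
  defines "K \<equiv> U * mat_adjoint V - z \<cdot>\<^sub>m 1\<^sub>m d"
  assumes eig: "mat_adjoint K *\<^sub>v (K *\<^sub>v w) = complex_of_real \<mu> \<cdot>\<^sub>v w"
    and least: "\<And>x. x \<in> carrier_vec d \<Longrightarrow> \<mu> * (l2_norm x)\<^sup>2 \<le> (l2_norm (K *\<^sub>v x))\<^sup>2"
  shows "eigenvalue (calM U V z) (complex_of_real \<mu>)"
proof -
  define Us Vs where "Us = mat_adjoint U" and "Vs = mat_adjoint V"
  have Us: "Us \<in> carrier_mat l d" and Vs: "Vs \<in> carrier_mat l d"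
    using U V by (simp_all add: Us_def Vs_def mat_adjoint_carrier)
  define q where "q = complex_of_real ((cmod z)\<^sup>2)"
  define X where "X a b = V *\<^sub>v a + V *\<^sub>v (Us *\<^sub>v (U *\<^sub>v b)) - cnj z \<cdot>\<^sub>v (U *\<^sub>v b)" for a b
  have dimM: "dim_row (calM U V z) = l + l"
    using U V by (simp add: calM_def Let_def)
  have M: "calM U V z *\<^sub>v (a @\<^sub>v b) = q \<cdot>\<^sub>v (a @\<^sub>v b) + ((- z) \<cdot>\<^sub>v (Us *\<^sub>v X a b) @\<^sub>v Vs *\<^sub>v X a b)"
    if "a \<in> carrier_vec l" "b \<in> carrier_vec l" for a b
    unfolding X_def q_def Us_def Vs_def using U V that by (rule calM_mult_append_vec)
  have "\<exists>a b. a \<in> carrier_vec l \<and> b \<in> carrier_vec l \<and> (a \<noteq> 0\<^sub>v l \<or> b \<noteq> 0\<^sub>v l) \<and>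
      calM U V z *\<^sub>v (a @\<^sub>v b) = complex_of_real \<mu> \<cdot>\<^sub>v (a @\<^sub>v b)"
  proof (cases "complex_of_real \<mu> = q")
    case True
    then have "\<mu> = (cmod z)\<^sup>2"
      unfolding q_def of_real_eq_iff .
    then obtain a b where ab: "a \<in> carrier_vec l" "b \<in> carrier_vec l" "a \<noteq> 0\<^sub>v l \<or> b \<noteq> 0\<^sub>v l"
      and X: "X a b = 0\<^sub>v d"
      using degenerate_kernel_vec[OF U V l, of z] least unfolding X_def K_def Us_def by metis
    have "calM U V z *\<^sub>v (a @\<^sub>v b) = complex_of_real \<mu> \<cdot>\<^sub>v (a @\<^sub>v b)"
      unfolding M[OF ab(1,2)] X True mult_mat_zero_vec[OF Us] mult_mat_zero_vec[OF Vs] smult_zero_vec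
      using ab(1,2) by (intro eq_vecI) auto
    then show ?thesis
      using ab by blast
  next
    case False
    \<comment> \<open>The witness is Y w. Since X (Y w) = (\<mu> - |z|^2) w is nonzero, so is Y w,
      and another application of Y gives the eigenvalue equation.\<close>
    define a b where "a = (- z) \<cdot>\<^sub>v (Us *\<^sub>v w)" and "b = Vs *\<^sub>v w"
    have ab: "a \<in> carrier_vec l" "b \<in> carrier_vec l"
      using Us Vs w by (simp_all add: a_def b_def)
    have Xc: "X a b \<in> carrier_vec d"
      using U V Us ab by (simp add: X_def)
    have "complex_of_real \<mu> \<cdot>\<^sub>v w = q \<cdot>\<^sub>v w + X a b"
      using low_rank_shift_normal_mult_vec[OF U V w(1), of z] eig
      by (simp add: X_def a_def b_def Us_def Vs_def K_def q_def)
    then have X: "X a b = (complex_of_real \<mu> - q) \<cdot>\<^sub>v w"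
      using Xc w by (auto simp: vec_eq_iff algebra_simps)
    have "a \<noteq> 0\<^sub>v l \<or> b \<noteq> 0\<^sub>v l"
    proof (rule ccontr)
      assume "\<not> (a \<noteq> 0\<^sub>v l \<or> b \<noteq> 0\<^sub>v l)"
      then have "X a b = 0\<^sub>v d"
        using mult_mat_zero_vec[OF U] mult_mat_zero_vec[OF V] mult_mat_zero_vec[OF Us]
        by (simp add: X_def smult_zero_vec)
      then have "(complex_of_real \<mu> - q) \<cdot>\<^sub>v w = 0\<^sub>v d"
        using X by simp
      then show False
        using False w by (auto simp: vec_eq_iff)
    qed
    moreover have "calM U V z *\<^sub>v (a @\<^sub>v b) = complex_of_real \<mu> \<cdot>\<^sub>v (a @\<^sub>v b)"
      unfolding M[OF ab] X mult_mat_vec[OF Us w(1)] mult_mat_vec[OF Vs w(1)]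
      using Us Vs w
      by (intro eq_vecI) (auto simp: a_def b_def algebra_simps simp del: index_mult_mat_vec)
    ultimately show ?thesis
      using ab by blast
  qed
  then obtain a b where ab: "a \<in> carrier_vec l" "b \<in> carrier_vec l" "a \<noteq> 0\<^sub>v l \<or> b \<noteq> 0\<^sub>v l"
    "calM U V z *\<^sub>v (a @\<^sub>v b) = complex_of_real \<mu> \<cdot>\<^sub>v (a @\<^sub>v b)"
    by blast
  have "0\<^sub>v l @\<^sub>v 0\<^sub>v l = (0\<^sub>v (l + l) :: complex Matrix.vec)"
    by (intro eq_vecI) auto
  then have "a @\<^sub>v b \<noteq> 0\<^sub>v (l + l)"
    using ab(1-3) append_vec_eq[OF ab(1) zero_carrier_vec, of b "0\<^sub>v l"] by metis
  then show ?thesis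
    unfolding eigenvalue_def eigenvector_def dimM using ab by blast
qed

text \<open>The Rayleigh quotient of K^* K at x dominates its smallest eigenvalue, which belongs to
  the spectrum of \<open>calM U V z\<close>. That spectrum is finite, so \<open>Min\<close> is a
  genuine minimum.\<close>

lemma lambda_min_calM_le:
  assumes U: "U \<in> carrier_mat d l" and V: "V \<in> carrier_mat d l" and l: "0 < l"
    and x: "x \<in> carrier_vec d" "x \<noteq> 0\<^sub>v d"
    and \<eta>: "l2_norm ((U * mat_adjoint V - z \<cdot>\<^sub>m 1\<^sub>m d) *\<^sub>v x) \<le> \<eta> * l2_norm x"
  shows "lambda_min (calM U V z) \<le> \<eta>\<^sup>2"
proof -
  define K where "K = U * mat_adjoint V - z \<cdot>\<^sub>m 1\<^sub>m d"
  have K: "K \<in> carrier_mat d d"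
    by (simp add: K_def minus_carrier_mat)
  have d: "0 < d"
    using x by (cases d) auto
  obtain \<mu> w where w: "w \<in> carrier_vec d" "w \<noteq> 0\<^sub>v d"
    and eig: "mat_adjoint K *\<^sub>v (K *\<^sub>v w) = complex_of_real \<mu> \<cdot>\<^sub>v w"
    and least: "\<And>x. x \<in> carrier_vec d \<Longrightarrow> \<mu> * (l2_norm x)\<^sup>2 \<le> (l2_norm (K *\<^sub>v x))\<^sup>2"
    using smallest_eigenvalue_adjoint_mult[OF K d] by metis
  have "calM U V z \<in> carrier_mat (l + l) (l + l)"
    using U V by (intro carrier_matI) (simp_all add: calM_def Let_def)
  then have fin: "finite (spectrum (calM U V z))"
    by (rule card_finite_spectrum)
  have "complex_of_real \<mu> \<in> spectrum (calM U V z)"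
    unfolding spectrum_def using eigenvalue_calM[OF U V l w, of z \<mu>] eig least by (simp add: K_def)
  then have "\<mu> \<in> Re ` spectrum (calM U V z)"
    by (metis Re_complex_of_real image_eqI)
  then have "lambda_min (calM U V z) \<le> \<mu>"
    unfolding lambda_min_def using fin by (intro Min_le) auto
  also have "\<mu> * (l2_norm x)\<^sup>2 \<le> (\<eta> * l2_norm x)\<^sup>2"
    using order_trans[OF least[OF x(1)] power_mono[OF \<eta> l2_norm_nonneg, of 2, folded K_def]] .
  then have "\<mu> \<le> \<eta>\<^sup>2"
    using l2_norm_pos_iff[OF x(1)] x(2) by (simp add: power_mult_distrib)
  finally show ?thesis .
qed

section \<open>Approximate singular vectors on the pseudospectrum\<close>

text \<open>The margin between \<epsilon> and \<epsilon>' avoids the question whether the supremum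
  in \<open>spectral_norm\<close> is attained; \<open>mu_le_of_mem_pseudospectrum\<close> lets it
  tend to zero.\<close>

lemma pseudospectrum_approx_vec:
  assumes A: "A \<in> carrier_mat d d" and d: "0 < d" and \<epsilon>: "0 < \<epsilon>" "\<epsilon> < \<epsilon>'"
    and z: "z \<in> pseudospectrum \<epsilon> A"
  obtains x where "x \<in> carrier_vec d" "x \<noteq> 0\<^sub>v d"
    "l2_norm ((A - z \<cdot>\<^sub>m 1\<^sub>m d) *\<^sub>v x) \<le> \<epsilon>' * l2_norm x"
proof -
  define B where "B = A - z \<cdot>\<^sub>m 1\<^sub>m d"
  have B: "B \<in> carrier_mat d d"
    by (simp add: B_def minus_carrier_mat)
  have le: "recip_norm_inverse B \<le> \<epsilon>"
    using z A by (simp add: pseudospectrum_def B_def)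
  have "\<exists>x\<in>carrier_vec d. x \<noteq> 0\<^sub>v d \<and> l2_norm (B *\<^sub>v x) \<le> \<epsilon>' * l2_norm x"
  proof (cases "mat_inverse B")
    case None
    then have "det B = 0"
      using mat_inverse(1)[OF B None, of "()"] det_non_zero_imp_unit[OF B, of "()"] by blast
    then obtain x where "x \<in> carrier_vec d" "x \<noteq> 0\<^sub>v d" "B *\<^sub>v x = 0\<^sub>v d"
      using det_0_iff_vec_prod_zero_field[OF B] by blast
    then show ?thesis
      using \<epsilon> by (intro bexI[of _ x]) auto
  next
    case (Some R)
    then have R: "R \<in> carrier_mat d d" "B * R = 1\<^sub>m d"
      using mat_inverse(2)[OF B Some] by auto
    have BR: "B *\<^sub>v (R *\<^sub>v v) = v" if "v \<in> carrier_vec d" for v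
      using assoc_mult_mat_vec[OF B R(1) that] R(2) that by simp
    show ?thesis
    proof (rule ccontr)
      \<comment> \<open>If |B x| > \<epsilon>' |x| for all nonzero x, the inverse has norm at most 1
        / \<epsilon>', and the reciprocal of that norm is at least \<epsilon>' > \<epsilon>.\<close>
      assume contra: "\<not> ?thesis"
      have "\<forall>v\<in>carrier_vec d. l2_norm (R *\<^sub>v v) \<le> inverse \<epsilon>' * l2_norm v"
      proof
        fix v :: "complex Matrix.vec"
        assume v: "v \<in> carrier_vec d"
        have "R *\<^sub>v v \<in> carrier_vec d"
          using R v by simp
        then have "\<epsilon>' * l2_norm (R *\<^sub>v v) \<le> l2_norm v"
          using contra BR[OF v] by (cases "R *\<^sub>v v = 0\<^sub>v d") (auto simp: not_le less_imp_le)
        then show "l2_norm (R *\<^sub>v v) \<le> inverse \<epsilon>' * l2_norm v"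
          using \<epsilon> by (simp add: field_simps)
      qed
      then have "spectral_norm R \<le> inverse \<epsilon>'"
        using spectral_norm_le_iff[OF R(1)] \<epsilon> by simp
      \<comment> \<open>Positivity matters because \<open>inverse 0 = 0\<close>: a vanishing norm
        would have the reciprocal 0 and not a large one.\<close>
      moreover have "0 < spectral_norm R"
      proof (rule ccontr)
        assume "\<not> 0 < spectral_norm R"
        then have "\<forall>v\<in>carrier_vec d. l2_norm (R *\<^sub>v v) \<le> 0 * l2_norm v"
          using spectral_norm_le_iff[OF R(1), of 0] by simp
        then have "l2_norm (R *\<^sub>v unit_vec d 0) = 0"
          using l2_norm_nonneg by (metis antisym mult_zero_left unit_vec_carrier)
        then have "R *\<^sub>v unit_vec d 0 = 0\<^sub>v d"
          using R l2_norm_eq_0_iff[of "R *\<^sub>v unit_vec d 0" d] by simp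
        then have "unit_vec d 0 = (0\<^sub>v d :: complex Matrix.vec)"
          using BR[of "unit_vec d 0"] mult_mat_zero_vec[OF B] by simp
        then show False
          using d by simp
      qed
      ultimately have "\<epsilon>' \<le> inverse (spectral_norm R)"
        using \<epsilon> le_imp_inverse_le[of "spectral_norm R" "inverse \<epsilon>'"] by simp
      then show False
        using le Some \<epsilon> by (simp add: recip_norm_inverse_def)
    qed
  qed
  then show ?thesis
    using that unfolding B_def by blast
qed

section \<open>Error of the projected and truncated decomposition\<close>

text \<open>A real matrix acts on real and imaginary parts separately, and their squared norms add
  up. This carries the error bound from real vectors to the complex test vectors.\<close>

lemma l2_norm_complex_mat_mult_vec_le:
  assumes B: "B \<in> carrier_mat m n" and c: "0 \<le> c"
    and bound: "\<And>x. x \<in> carrier_vec n \<Longrightarrow> l2_norm (B *\<^sub>v x) \<le> c * l2_norm x"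
    and x: "x \<in> carrier_vec n"
  shows "l2_norm (complex_mat B *\<^sub>v x) \<le> c * l2_norm x"
proof -
  have split: "(l2_norm v)\<^sup>2 = (l2_norm (map_vec Re v))\<^sup>2 + (l2_norm (map_vec Im v))\<^sup>2"
    for v :: "complex Matrix.vec"
    by (simp add: l2_norm_def L2_set_def sum_nonneg cmod_power2 sum.distrib)
  have "map_vec Re (complex_mat B *\<^sub>v x) = B *\<^sub>v map_vec Re x"
    "map_vec Im (complex_mat B *\<^sub>v x) = B *\<^sub>v map_vec Im x"
    using B x by (auto intro!: eq_vecI simp: scalar_prod_def)
  then have "(l2_norm (complex_mat B *\<^sub>v x))\<^sup>2 =
      (l2_norm (B *\<^sub>v map_vec Re x))\<^sup>2 + (l2_norm (B *\<^sub>v map_vec Im x))\<^sup>2"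
    by (simp only: split[of "complex_mat B *\<^sub>v x"])
  also have "\<dots> \<le> (c * l2_norm (map_vec Re x))\<^sup>2 + (c * l2_norm (map_vec Im x))\<^sup>2"
    using bound x by (intro add_mono power_mono) auto
  also have "\<dots> = (c * l2_norm x)\<^sup>2"
    by (simp only: power_mult_distrib split[of x] distrib_left)
  finally show ?thesis
    by (rule power2_le_imp_le) (simp add: c)
qed

lemma scalar_prod_le_l2_norm:
  fixes v w :: "real Matrix.vec"
  assumes "v \<in> carrier_vec n" "w \<in> carrier_vec n"
  shows "v \<bullet> w \<le> l2_norm v * l2_norm w"
proof -
  have "v \<bullet> w \<le> (\<Sum>i<n. \<bar>v $ i\<bar> * \<bar>w $ i\<bar>)"
    using assms by (auto simp: scalar_prod_def atLeast0LessThan simp flip: abs_mult intro!: sum_mono)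
  also have "\<dots> \<le> l2_norm v * l2_norm w"
    using L2_set_mult_ineq[of "\<lambda>i. \<bar>v $ i\<bar>" "\<lambda>i. \<bar>w $ i\<bar>" "{..<n}"] assms
    by (simp add: l2_norm_def)
  finally show ?thesis .
qed

lemma l2_norm_isometry:
  fixes W :: "real mat"
  assumes W: "W \<in> carrier_mat m n" "W\<^sup>T * W = 1\<^sub>m n" and x: "x \<in> carrier_vec n"
  shows "l2_norm (W *\<^sub>v x) = l2_norm x"
proof -
  have "(l2_norm (W *\<^sub>v x))\<^sup>2 = (W\<^sup>T *\<^sub>v (W *\<^sub>v x)) \<bullet> x"
    using W x transpose_vec_mult_scalar[OF W(1) x, of "W *\<^sub>v x"] by (simp add: real_l2_norm_squared)
  also have "W\<^sup>T *\<^sub>v (W *\<^sub>v x) = x"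
    using W x assoc_mult_mat_vec[of "W\<^sup>T" n m W n x] by simp
  finally show ?thesis
    by (simp flip: real_l2_norm_squared)
qed

text \<open>W^T is not isometric if W has more rows than columns, but y = W^T x satisfies |y|^2 =
  <x, W y> \<le> |x| |y|.\<close>

lemma l2_norm_transpose_isometry_le:
  fixes W :: "real mat"
  assumes W: "W \<in> carrier_mat m n" "W\<^sup>T * W = 1\<^sub>m n" and x: "x \<in> carrier_vec m"
  shows "l2_norm (W\<^sup>T *\<^sub>v x) \<le> l2_norm x"
proof -
  define y where "y = W\<^sup>T *\<^sub>v x"
  have y: "y \<in> carrier_vec n"
    using W x by (simp add: y_def)
  have "(l2_norm y)\<^sup>2 = x \<bullet> (W *\<^sub>v y)"
    using transpose_vec_mult_scalar[OF W(1) y x] by (simp add: real_l2_norm_squared y_def)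
  also have "\<dots> \<le> l2_norm x * l2_norm y"
    using scalar_prod_le_l2_norm[of x m "W *\<^sub>v y"] W x y l2_norm_isometry[OF W y] by simp
  finally have "l2_norm y * l2_norm y \<le> l2_norm x * l2_norm y"
    by (simp add: power2_eq_square)
  then show ?thesis
    using l2_norm_nonneg[of y] l2_norm_nonneg[of x] unfolding y_def[symmetric]
    by (cases "l2_norm y = 0") auto
qed

lemma l2_norm_mat_diag_mult_vec_le:
  fixes f :: "nat \<Rightarrow> real"
  assumes x: "x \<in> carrier_vec n" and f: "\<And>i. i < n \<Longrightarrow> \<bar>f i\<bar> \<le> c"
  shows "l2_norm (mat_diag n f *\<^sub>v x) \<le> c * l2_norm x"
\<comment> \<open>Without any index the assumption on \<open>f\<close> leaves the sign of
  \<open>c\<close> open; both sides are then zero.\<close>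
proof (cases "n = 0")
  case True
  then show ?thesis
    using x by (simp add: l2_norm_def mat_diag_def)
next
  case False
  then have c: "0 \<le> c"
    using f[of 0] by simp
  have "(mat_diag n f *\<^sub>v x) $ i = f i * x $ i" if i: "i < n" for i
    using x i by (simp add: mat_diag_def scalar_prod_def if_distrib[of "\<lambda>u. u * _"] cong: if_cong)
  then have "l2_norm (mat_diag n f *\<^sub>v x) = L2_set (\<lambda>i. \<bar>f i\<bar> * \<bar>x $ i\<bar>) {..<n}"
    by (auto simp: l2_norm_def mat_diag_def abs_mult intro!: L2_set_cong)
  also have "\<dots> \<le> L2_set (\<lambda>i. c * \<bar>x $ i\<bar>) {..<n}"
    using f by (intro L2_set_mono mult_right_mono) auto
  also have "\<dots> = c * l2_norm x"
    using x c by (simp add: l2_norm_def L2_set_right_distrib)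
  finally show ?thesis .
qed

lemma first_cols_carrier: "A \<in> carrier_mat m n \<Longrightarrow> l \<le> n \<Longrightarrow> first_cols l A \<in> carrier_mat m l"
  by (auto simp: first_cols_def)

lemma index_first_cols:
  assumes "A \<in> carrier_mat m n" "l \<le> n" "i < m" "j < l"
  shows "first_cols l A $$ (i, j) = A $$ (i, j)"
  using assms by (simp add: first_cols_def mat_of_cols_index)

text \<open>The tail is padded with zeros to size k instead of being cut down to k - l columns, so
  that U and V stay whole and keep their orthonormal columns.\<close>

lemma svd_minus_truncation:
  fixes U V :: "real mat"
  assumes U: "U \<in> carrier_mat k k" and V: "V \<in> carrier_mat d k" and l: "l \<le> k"
  shows "U * sv_diag k \<sigma> * V\<^sup>T - first_cols l U * (first_cols l V * sv_diag l \<sigma>)\<^sup>T =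
    U * mat_diag k (\<lambda>i. if i < l then 0 else \<sigma> (Suc i)) * V\<^sup>T"
    (is "?L = ?R")
proof (rule eq_matI)
  fix i j assume "i < dim_row ?R" "j < dim_col ?R"
  then have ij: "i < k" "j < d"
    using U V by auto
  have diag: "(U * mat_diag k f * V\<^sup>T) $$ (i, j) = (\<Sum>r<k. U $$ (i, r) * f r * V $$ (j, r))" for f
    using ij U V by (simp add: mat_diag_mult_right[OF U] scalar_prod_def atLeast0LessThan)
  note F = first_cols_carrier[OF V l]
  have "(first_cols l U * (first_cols l V * sv_diag l \<sigma>)\<^sup>T) $$ (i, j) =
      (\<Sum>r<l. U $$ (i, r) * \<sigma> (Suc r) * V $$ (j, r))"
    using ij l first_cols_carrier[OF U l] F
    by (simp add: sv_diag_def mat_diag_mult_right[OF F] scalar_prod_def atLeast0LessThan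
        index_first_cols[OF U l] index_first_cols[OF V l] mult_ac)
  also have "\<dots> = (\<Sum>r<k. if r < l then U $$ (i, r) * \<sigma> (Suc r) * V $$ (j, r) else 0)"
    using l by (intro sum.mono_neutral_cong_left) auto
  finally show "?L $$ (i, j) = ?R $$ (i, j)"
    using ij U V F first_cols_carrier[OF U l] unfolding sv_diag_def
    by (simp add: diag sum_subtractf[symmetric] del: index_mult_mat(1))
      (auto intro!: sum.cong)
qed (use U V first_cols_carrier[OF U l] first_cols_carrier[OF V l] in auto)

text \<open>The error is (I - Q Q^T) A plus Q times the tail of the decomposition of Q^T A. The
  first part has norm at most \<alpha>; in the second, Q and U preserve norms, V^T does not increase
  them, and the tail begins with \<sigma> (l + 1).\<close>

lemma truncated_projection_error:
  fixes A Q U V :: "real mat"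
  assumes A: "A \<in> carrier_mat d d" and l: "l < k"
    and Q: "Q \<in> carrier_mat d k" "Q\<^sup>T * Q = 1\<^sub>m k"
    and svd: "is_svd (Q\<^sup>T * A) U \<sigma> V"
    and \<alpha>: "spectral_norm ((1\<^sub>m d - Q * Q\<^sup>T) * A) \<le> \<alpha>"
    and x: "x \<in> carrier_vec d"
  shows "l2_norm ((A - Q * first_cols l U * (first_cols l V * sv_diag l \<sigma>)\<^sup>T) *\<^sub>v x) \<le>
    (\<sigma> (l + 1) + \<alpha>) * l2_norm x"
proof -
  have U: "U \<in> carrier_mat k k" "U\<^sup>T * U = 1\<^sub>m k" and V: "V \<in> carrier_mat d k" "V\<^sup>T * V = 1\<^sub>m k"
    and nonneg: "\<And>i. i \<in> {1..k} \<Longrightarrow> 0 \<le> \<sigma> i" and anti: "antimono_on {1..k} \<sigma>"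
    and QA: "Q\<^sup>T * A = U * sv_diag k \<sigma> * V\<^sup>T"
    using svd A Q by (auto simp: is_svd_def Let_def)
  define W where "W = (first_cols l V * sv_diag l \<sigma>)\<^sup>T"
  define D where "D = mat_diag k (\<lambda>i. if i < l then 0 else \<sigma> (Suc i))"
  note FU = first_cols_carrier[OF U(1), of l] and FV = first_cols_carrier[OF V(1), of l]
  have FU': "first_cols l U \<in> carrier_mat k l" and W: "W \<in> carrier_mat l d"
    using FU FV l by (auto simp: W_def sv_diag_def mat_diag_def)
  have D: "D \<in> carrier_mat k k"
    by (simp add: D_def)
  have P: "(1\<^sub>m d - Q * Q\<^sup>T) * A \<in> carrier_mat d d"
    using A Q by auto
  have tr: "U * D * V\<^sup>T = Q\<^sup>T * A - first_cols l U * W"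
    unfolding QA D_def W_def by (rule svd_minus_truncation[symmetric]) (use U V l in auto)
  have "A - Q * first_cols l U * W = (1\<^sub>m d - Q * Q\<^sup>T) * A + Q * (U * D * V\<^sup>T)"
  proof -
    have "(1\<^sub>m d - Q * Q\<^sup>T) * A = A - Q * (Q\<^sup>T * A)"
      using A Q by (subst minus_mult_distrib_mat[of _ d d]) auto
    moreover have "Q * (U * D * V\<^sup>T) = Q * (Q\<^sup>T * A) - Q * (first_cols l U * W)"
      unfolding tr using A Q FU' W by (intro mult_minus_distrib_mat[of _ d k _ d]) auto
    moreover have "Q * first_cols l U * W = Q * (first_cols l U * W)"
      using Q FU' W by (intro assoc_mult_mat) auto
    ultimately show ?thesis
      using A Q FU' W by (intro eq_matI) (auto simp del: index_mult_mat(1))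
  qed
  then have "(A - Q * first_cols l U * W) *\<^sub>v x =
      ((1\<^sub>m d - Q * Q\<^sup>T) * A) *\<^sub>v x + (Q * (U * D * V\<^sup>T)) *\<^sub>v x"
    using P Q U D V x by (simp add: add_mult_distrib_mat_vec[of _ d d] del: assoc_mult_mat_vec)
  also have "(Q * (U * D * V\<^sup>T)) *\<^sub>v x = Q *\<^sub>v (U *\<^sub>v (D *\<^sub>v (V\<^sup>T *\<^sub>v x)))"
  proof -
    have UD: "U * D \<in> carrier_mat k k" and VT: "V\<^sup>T \<in> carrier_mat k d"
      using U D V by auto
    show ?thesis
      using U V x assoc_mult_mat_vec[OF Q(1) mult_carrier_mat[OF UD VT] x] assoc_mult_mat_vec[OF UD VT x]
        assoc_mult_mat_vec[OF U(1) D, of "V\<^sup>T *\<^sub>v x"] by simp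
  qed
  finally have "l2_norm ((A - Q * first_cols l U * W) *\<^sub>v x) \<le>
      l2_norm (((1\<^sub>m d - Q * Q\<^sup>T) * A) *\<^sub>v x) + l2_norm (Q *\<^sub>v (U *\<^sub>v (D *\<^sub>v (V\<^sup>T *\<^sub>v x))))"
    using l2_norm_add_le[of "((1\<^sub>m d - Q * Q\<^sup>T) * A) *\<^sub>v x" d "Q *\<^sub>v (U *\<^sub>v (D *\<^sub>v (V\<^sup>T *\<^sub>v x)))"]
      mult_mat_vec_carrier[OF P x] mult_mat_vec_carrier[OF Q(1)] U D V x by simp
  also have "l2_norm (((1\<^sub>m d - Q * Q\<^sup>T) * A) *\<^sub>v x) \<le> \<alpha> * l2_norm x"
    using spectral_norm_le_iff[OF P, of \<alpha>] order_trans[OF spectral_norm_nonneg \<alpha>] \<alpha> x by blast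
  also have "l2_norm (Q *\<^sub>v (U *\<^sub>v (D *\<^sub>v (V\<^sup>T *\<^sub>v x)))) = l2_norm (D *\<^sub>v (V\<^sup>T *\<^sub>v x))"
    using l2_norm_isometry[OF Q] l2_norm_isometry[OF U] U D V x by simp
  also have "\<dots> \<le> \<sigma> (l + 1) * l2_norm (V\<^sup>T *\<^sub>v x)"
    unfolding D_def
  proof (rule l2_norm_mat_diag_mult_vec_le)
    \<comment> \<open>Entry i of the diagonal is singular value \<open>Suc i\<close>, so the first
      surviving one, i = l, is \<sigma> (l + 1); l < k keeps l + 1 in the range where \<sigma> is
      antitone.\<close>
    fix i assume "i < k"
    then show "\<bar>if i < l then 0 else \<sigma> (Suc i)\<bar> \<le> \<sigma> (l + 1)"
      using nonneg[of "l + 1"] nonneg[of "Suc i"] l monotone_onD[OF anti, of "l + 1" "Suc i"] by auto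
  qed (use V x in simp)
  also have "\<dots> \<le> \<sigma> (l + 1) * l2_norm x"
    using l2_norm_transpose_isometry_le[OF V x] nonneg[of "l + 1"] l by (intro mult_left_mono) auto
  finally show ?thesis
    by (simp add: W_def distrib_right)
qed

section \<open>The inclusion, and measurability of the exceptional event\<close>

text \<open>Replacing A by U V^T changes the image of a vector x by at most c |x|, so an approximate
  vector for A is a test vector for \<open>lambda_min_calM_le\<close>.\<close>

lemma mu_le_of_mem_pseudospectrum:
  fixes A U V :: "real mat"
  assumes A: "A \<in> carrier_mat d d" and U: "U \<in> carrier_mat d l" and V: "V \<in> carrier_mat d l"
    and d: "0 < d" and l: "0 < l" and \<epsilon>: "0 < \<epsilon>" and c: "0 \<le> c"
    and bound: "\<And>x. x \<in> carrier_vec d \<Longrightarrow> l2_norm ((A - U * V\<^sup>T) *\<^sub>v x) \<le> c * l2_norm x"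
    and z: "z \<in> pseudospectrum \<epsilon> (complex_mat A)"
  shows "mu (complex_mat U) (complex_mat V) z \<le> \<epsilon> + c"
proof (rule field_le_epsilon)
  fix e :: real
  assume e: "0 < e"
  have cA: "complex_mat A \<in> carrier_mat d d" and cU: "complex_mat U \<in> carrier_mat d l"
    and cV: "complex_mat V \<in> carrier_mat d l" and E: "A - U * V\<^sup>T \<in> carrier_mat d d"
    using A U V by (auto simp: minus_carrier_mat)
  obtain x where x: "x \<in> carrier_vec d" "x \<noteq> 0\<^sub>v d"
    and xe: "l2_norm ((complex_mat A - z \<cdot>\<^sub>m 1\<^sub>m d) *\<^sub>v x) \<le> (\<epsilon> + e) * l2_norm x"
    using pseudospectrum_approx_vec[OF cA d \<epsilon> _ z, of "\<epsilon> + e"] e by auto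
  have "complex_mat U * mat_adjoint (complex_mat V) = complex_mat (U * V\<^sup>T)"
    unfolding mat_adjoint_complex_mat using U V by (simp add: of_real_hom.mat_hom_mult[of _ d l _ d])
  then have "complex_mat U * mat_adjoint (complex_mat V) - z \<cdot>\<^sub>m 1\<^sub>m d =
      (complex_mat A - z \<cdot>\<^sub>m 1\<^sub>m d) - complex_mat (A - U * V\<^sup>T)"
    using A U V by (intro eq_matI) (auto simp del: index_mult_mat(1))
  then have "(complex_mat U * mat_adjoint (complex_mat V) - z \<cdot>\<^sub>m 1\<^sub>m d) *\<^sub>v x =
      (complex_mat A - z \<cdot>\<^sub>m 1\<^sub>m d) *\<^sub>v x - complex_mat (A - U * V\<^sup>T) *\<^sub>v x"
    using E x by (simp add: minus_mult_distrib_mat_vec[of _ d d] minus_carrier_mat)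
  then have "l2_norm ((complex_mat U * mat_adjoint (complex_mat V) - z \<cdot>\<^sub>m 1\<^sub>m d) *\<^sub>v x) \<le>
      l2_norm ((complex_mat A - z \<cdot>\<^sub>m 1\<^sub>m d) *\<^sub>v x) + l2_norm (complex_mat (A - U * V\<^sup>T) *\<^sub>v x)"
    using E x mult_mat_vec_carrier[of "complex_mat A - z \<cdot>\<^sub>m 1\<^sub>m d" d d x]
      mult_mat_vec_carrier[of "complex_mat (A - U * V\<^sup>T)" d d x]
    by (simp add: l2_norm_minus_le[of _ d] minus_carrier_mat)
  also have "\<dots> \<le> (\<epsilon> + e) * l2_norm x + c * l2_norm x"
    using xe l2_norm_complex_mat_mult_vec_le[OF E c bound x(1)] by (rule add_mono)
  also have "\<dots> = (\<epsilon> + c + e) * l2_norm x"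
    by (simp add: algebra_simps)
  finally have "lambda_min (calM (complex_mat U) (complex_mat V) z) \<le> (\<epsilon> + c + e)\<^sup>2"
    by (rule lambda_min_calM_le[OF cU cV l x])
  then show "mu (complex_mat U) (complex_mat V) z \<le> \<epsilon> + c + e"
    unfolding mu_def using \<epsilon> c e by (intro real_le_lsqrt) auto
qed

text \<open>The sublevel sets of the spectral norm are intersections of closed sets of matrices, one for
  each test vector, so the uncountable supremum causes no measurability problem.\<close>

lemma spectral_norm_gt_measurable:
  fixes B :: "'w \<Rightarrow> real mat"
  assumes B: "\<And>\<omega>. \<omega> \<in> space M \<Longrightarrow> B \<omega> \<in> carrier_mat m n"
    and meas: "\<And>i j. i < m \<Longrightarrow> j < n \<Longrightarrow> (\<lambda>\<omega>. B \<omega> $$ (i, j)) \<in> borel_measurable M"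
  shows "{\<omega> \<in> space M. \<alpha> < spectral_norm (B \<omega>)} \<in> sets M"
proof (cases "\<alpha> < 0")
  \<comment> \<open>\<open>spectral_norm_le_iff\<close> asks for a nonnegative bound; below zero the
    event is the whole space.\<close>
  case True
  then have "{\<omega> \<in> space M. \<alpha> < spectral_norm (B \<omega>)} = space M"
    using less_le_trans[OF _ spectral_norm_nonneg] by blast
  then show ?thesis by simp
next
  case False
  \<comment> \<open>Matrices are encoded by their entry functions, so that closedness refers to the
    product topology.\<close>
  define C where "C = (\<Inter>v\<in>carrier_vec n. {F :: nat \<times> nat \<Rightarrow> real.
    l2_norm (Matrix.mat m n F *\<^sub>v v) \<le> \<alpha> * l2_norm v})"
  have "closed C"
    unfolding C_def
  proof (rule closed_INT, rule ballI, rule closed_Collect_le)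
    fix v :: "real Matrix.vec"
    assume v: "v \<in> carrier_vec n"
    have "l2_norm (Matrix.mat m n F *\<^sub>v v) = sqrt (\<Sum>i<m. (\<Sum>j<n. F (i, j) * v $ j)\<^sup>2)"
      for F :: "nat \<times> nat \<Rightarrow> real"
      using v by (simp add: l2_norm_def L2_set_def scalar_prod_def atLeast0LessThan)
    then show "continuous_on UNIV (\<lambda>F. l2_norm (Matrix.mat m n F *\<^sub>v v))"
      by (simp add: continuous_intros)
  qed (intro continuous_intros)
  then have C: "C \<in> sets borel"
    by (rule borel_closed)
  \<comment> \<open>Zero outside the index range makes every coordinate measurable; the pairs of
    naturals being countable, \<open>f\<close> is then Borel measurable as a whole.\<close>
  define f where "f \<omega> p = (if fst p < m \<and> snd p < n then B \<omega> $$ p else 0)" for \<omega> p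
  have f: "f \<in> borel_measurable M"
  proof (rule measurable_coordinatewise_then_product)
    show "(\<lambda>\<omega>. f \<omega> p) \<in> borel_measurable M" for p
      using meas[of "fst p" "snd p"] by (cases "fst p < m \<and> snd p < n") (auto simp: f_def)
  qed
  have "Matrix.mat m n (f \<omega>) = B \<omega>" if "\<omega> \<in> space M" for \<omega>
    using B[OF that] by (intro eq_matI) (auto simp: f_def)
  then have "f \<omega> \<in> C \<longleftrightarrow> spectral_norm (B \<omega>) \<le> \<alpha>" if "\<omega> \<in> space M" for \<omega>
    using spectral_norm_le_iff[OF B[OF that], of \<alpha>] False that by (simp add: C_def)
  then have "{\<omega> \<in> space M. \<alpha> < spectral_norm (B \<omega>)} = space M - f -` C \<inter> space M"
    by auto
  then show ?thesis
    using measurable_sets[OF f C] by auto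
qed

theorem corollary2:
  fixes A :: "real mat" and d k l :: nat and \<epsilon> \<delta> \<alpha> :: real
    and M :: "'w measure" and Q Uh Vh :: "'w \<Rightarrow> real mat" and \<sigma> :: "'w \<Rightarrow> nat \<Rightarrow> real"
  assumes "A \<in> carrier_mat d d"
    and "1 \<le> l" and "l < k" and "k < d"
    and "0 < \<epsilon>"
    and "prob_space M"
    and "random_matrix M d k Q"
    and "\<And>\<omega>. \<omega> \<in> space M \<Longrightarrow> (Q \<omega>)\<^sup>T * Q \<omega> = 1\<^sub>m k"
    and "0 < \<delta>" and "\<delta> \<le> 1"
    and "measure M {\<omega> \<in> space M. spectral_norm ((1\<^sub>m d - Q \<omega> * (Q \<omega>)\<^sup>T) * A) > \<alpha>} \<le> \<delta>"
    and "\<And>\<omega>. \<omega> \<in> space M \<Longrightarrow> is_svd ((Q \<omega>)\<^sup>T * A) (Uh \<omega>) (\<sigma> \<omega>) (Vh \<omega>)"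
  shows "with_prob_at_least M (1 - \<delta>) (\<lambda>\<omega>.
    pseudospectrum \<epsilon> (complex_mat A) \<subseteq>
      {z. mu (complex_mat (Q \<omega> * first_cols l (Uh \<omega>)))
             (complex_mat (first_cols l (Vh \<omega>) * sv_diag l (\<sigma> \<omega>))) z
          \<le> \<epsilon> + \<sigma> \<omega> (l + 1) + \<alpha>})"
proof -
  interpret prob_space M by fact
  note A = assms(1)
  have Q: "Q \<omega> \<in> carrier_mat d k" if "\<omega> \<in> space M" for \<omega>
    using assms(7) that by (auto simp: random_matrix_def)
  have Qm [measurable]: "(\<lambda>\<omega>. Q \<omega> $$ (i, j)) \<in> borel_measurable M" if "i < d" "j < k" for i j
    using assms(7) that by (auto simp: random_matrix_def)
  define P where "P \<omega> = (1\<^sub>m d - Q \<omega> * (Q \<omega>)\<^sup>T) * A" for \<omega>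
  \<comment> \<open>This event depends on the sample through Q alone, so a nonmeasurable choice of
    singular vectors does no harm; its complement is the witness for
    \<open>with_prob_at_least\<close>.\<close>
  define F where "F = {\<omega> \<in> space M. \<alpha> < spectral_norm (P \<omega>)}"
  have F: "F \<in> sets M"
    unfolding F_def
  proof (rule spectral_norm_gt_measurable)
    show "P \<omega> \<in> carrier_mat d d" if "\<omega> \<in> space M" for \<omega>
      using A Q[OF that] by (auto simp: P_def)
    fix i j assume ij: "i < d" "j < d"
    have eq: "P \<omega> $$ (i, j) = (\<Sum>r<d. ((if i = r then 1 else 0) - (\<Sum>s<k. Q \<omega> $$ (i, s) * Q \<omega> $$ (r, s))) * A $$ (r, j))"
      if "\<omega> \<in> space M" for \<omega>
      using A Q[OF that] ij by (simp add: P_def scalar_prod_def atLeast0LessThan)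
    have "(\<lambda>\<omega>. \<Sum>r<d. ((if i = r then 1 else 0) - (\<Sum>s<k. Q \<omega> $$ (i, s) * Q \<omega> $$ (r, s))) * A $$ (r, j))
        \<in> borel_measurable M"
      using ij by (intro borel_measurable_sum borel_measurable_times borel_measurable_diff Qm) auto
    then show "(\<lambda>\<omega>. P \<omega> $$ (i, j)) \<in> borel_measurable M"
      by (subst measurable_cong[OF eq])
  qed
  show ?thesis
    unfolding with_prob_at_least_def
  proof (intro bexI[of _ "space M - F"] conjI ballI subsetI CollectI)
    show "space M - F \<in> sets M"
      using F by auto
    show "1 - \<delta> \<le> measure M (space M - F)"
      using assms(11) prob_compl[OF F] by (simp add: F_def P_def)
    fix \<omega> z
    assume "\<omega> \<in> space M - F" and z: "z \<in> pseudospectrum \<epsilon> (complex_mat A)"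
    then have \<omega>: "\<omega> \<in> space M" and small: "spectral_norm ((1\<^sub>m d - Q \<omega> * (Q \<omega>)\<^sup>T) * A) \<le> \<alpha>"
      by (auto simp: F_def P_def)
    have svd: "Uh \<omega> \<in> carrier_mat k k" "Vh \<omega> \<in> carrier_mat d k" "\<forall>i\<in>{1..k}. 0 \<le> \<sigma> \<omega> i"
      using assms(12)[OF \<omega>] Q[OF \<omega>] A by (auto simp: is_svd_def Let_def)
    have U: "Q \<omega> * first_cols l (Uh \<omega>) \<in> carrier_mat d l"
      using Q[OF \<omega>] first_cols_carrier[OF svd(1), of l] assms(3) by auto
    have V: "first_cols l (Vh \<omega>) * sv_diag l (\<sigma> \<omega>) \<in> carrier_mat d l"
      using first_cols_carrier[OF svd(2), of l] assms(3) by (auto simp: sv_diag_def)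
    have "0 \<le> \<sigma> \<omega> (l + 1)"
      using svd(3) assms(3) by auto
    \<comment> \<open>The sign comes from the norm that \<alpha> dominates at this sample; for
      negative \<alpha> no sample lies outside \<open>F\<close>.\<close>
    moreover have "0 \<le> \<alpha>"
      using spectral_norm_nonneg small by (rule order_trans)
    ultimately have "mu (complex_mat (Q \<omega> * first_cols l (Uh \<omega>)))
        (complex_mat (first_cols l (Vh \<omega>) * sv_diag l (\<sigma> \<omega>))) z \<le> \<epsilon> + (\<sigma> \<omega> (l + 1) + \<alpha>)"
      using truncated_projection_error[OF A assms(3) Q[OF \<omega>] assms(8)[OF \<omega>] assms(12)[OF \<omega>] small]
        assms(2,4,5)
      by (intro mu_le_of_mem_pseudospectrum[OF A U V _ _ _ _ _ z]) auto
    then show "mu (complex_mat (Q \<omega> * first_cols l (Uh \<omega>)))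
        (complex_mat (first_cols l (Vh \<omega>) * sv_diag l (\<sigma> \<omega>))) z \<le> \<epsilon> + \<sigma> \<omega> (l + 1) + \<alpha>"
      by simp
  qed
qed

end
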